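(* There is a finite presentation $P$ of a group with solvable word problem (namely, the Baumslag--Solitar presentation $P=\mathrm{BS}(2,3)=\langle s,t\mid s^{-1}t^{2}s=t^{3}\rangle$) for which there is no partial algorithm that, on input of a recursive presentation $Q$ such that $\overline{P}\cong\overline{Q}$, outputs a solution to the word problem for $Q$.
   Context: Notation: for a group presentation $P=\langle X\mid R\rangle$, $\overline{P}$ denotes the group presented by $P$. A presentation $\langle Y\mid S\rangle$ is a recursive presentation if $Y$ is a finite set and $S$ is a recursive enumeration of relators (words on $Y\cup Y^{-1}$); such a presentation is given as input to an algorithm by $Y$ together with a description of a machine enumerating $S$. A solution to the word problem for $Q=\langle Y\mid S\rangle$ is an algorithm that, on input of any finite word on $Y\cup Y^{-1}$, decides whether that word represents the identity in $\overline{Q}$. A partial algorithm on inputs satisfying a condition is required to halt with correct output on all inputs satisfying the condition, with nothing required on other inputs. *)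

theory Defs
  imports "HOL-Library.Nat_Bijection" "HOL-Algebra.Group"
begin

section \<open>Presentations and presented groups\<close>

datatype 'a letter = Gen 'a | Inv 'a

fun inv_letter :: "'a letter \<Rightarrow> 'a letter" where
  "inv_letter (Gen a) = Inv a"
| "inv_letter (Inv a) = Gen a"

definition letters :: "'a set \<Rightarrow> 'a letter set" where
  "letters Y = Gen ` Y \<union> Inv ` Y"

definition words :: "'a set \<Rightarrow> 'a letter list set" where
  "words Y = lists (letters Y)"

text \<open>A pair \<open>(Y, S)\<close> stands for the presentation with generators \<open>Y\<close> and relators \<open>S\<close>.\<close>

type_synonym 'a presentation = "'a set \<times> 'a letter list set"

definition is_presentation :: "'a presentation \<Rightarrow> bool" where
  "is_presentation P \<longleftrightarrow> snd P \<subseteq> words (fst P)"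

definition finite_presentation :: "'a presentation \<Rightarrow> bool" where
  "finite_presentation P \<longleftrightarrow> is_presentation P \<and> finite (fst P) \<and> finite (snd P)"

text \<open>The least congruence on the monoid of words that makes every letter cancel against its
  formal inverse and every relator trivial.\<close>

inductive word_eq :: "'a presentation \<Rightarrow> 'a letter list \<Rightarrow> 'a letter list \<Rightarrow> bool"
  for P :: "'a presentation" where
  refl: "w \<in> words (fst P) \<Longrightarrow> word_eq P w w"
| sym: "word_eq P v w \<Longrightarrow> word_eq P w v"
| trans: "word_eq P u v \<Longrightarrow> word_eq P v w \<Longrightarrow> word_eq P u w"
| cancel: "u \<in> words (fst P) \<Longrightarrow> v \<in> words (fst P) \<Longrightarrow> x \<in> letters (fst P) \<Longrightarrow>
    word_eq P (u @ [x, inv_letter x] @ v) (u @ v)"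
| relator: "u \<in> words (fst P) \<Longrightarrow> v \<in> words (fst P) \<Longrightarrow> r \<in> snd P \<Longrightarrow>
    word_eq P (u @ r @ v) (u @ v)"

definition word_class :: "'a presentation \<Rightarrow> 'a letter list \<Rightarrow> 'a letter list set" where
  "word_class P w = {v. word_eq P w v}"

definition presented_group :: "'a presentation \<Rightarrow> 'a letter list set monoid" where
  "presented_group P =
    \<lparr>carrier = word_class P ` words (fst P),
     monoid.mult = (\<lambda>A B. \<Union>a\<in>A. \<Union>b\<in>B. word_class P (a @ b)),
     one = word_class P []\<rparr>"

text \<open>The Baumslag--Solitar presentation with generators \<open>s = 0\<close>, \<open>t = 1\<close> and the
  relation \<open>s\<inverse> t\<^sup>m s = t\<^sup>n\<close>.\<close>

definition BS :: "nat \<Rightarrow> nat \<Rightarrow> nat presentation" where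
  "BS m n = ({0, 1}, {[Inv 0] @ replicate m (Gen 1) @ [Gen 0] @ replicate n (Inv 1)})"

lemma words_append [simp]: "u @ v \<in> words Y \<longleftrightarrow> u \<in> words Y \<and> v \<in> words Y"
  by (auto simp: words_def)

lemma words_Nil [simp]: "[] \<in> words Y"
  by (auto simp: words_def)

lemma words_Cons [simp]: "x # v \<in> words Y \<longleftrightarrow> x \<in> letters Y \<and> v \<in> words Y"
  by (auto simp: words_def)

lemma inv_letter_letters [simp]: "inv_letter x \<in> letters Y \<longleftrightarrow> x \<in> letters Y"
  by (cases x) (auto simp: letters_def)

lemma inv_letter_inv_letter [simp]: "inv_letter (inv_letter x) = x"
  by (cases x) auto

lemma rev_inv_words [simp]: "rev (map inv_letter w) \<in> words Y \<longleftrightarrow> w \<in> words Y"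
  by (induction w) auto

lemma word_eq_words:
  assumes "is_presentation P" "word_eq P v w"
  shows "v \<in> words (fst P) \<and> w \<in> words (fst P)"
  using assms(2)
proof induction
  case (relator u v r)
  then show ?case using assms(1) by (auto simp: is_presentation_def)
qed auto

lemma word_eq_context:
  assumes "word_eq P v w" "p \<in> words (fst P)" "q \<in> words (fst P)"
  shows "word_eq P (p @ v @ q) (p @ w @ q)"
  using assms(1)
proof induction
  case (cancel u v x)
  then show ?case using word_eq.cancel[of "p @ u" P "v @ q" x] assms by simp
next
  case (relator u v r)
  then show ?case using word_eq.relator[of "p @ u" P "v @ q" r] assms by simp
next
  case (refl w)
  then show ?case using assms by (intro word_eq.refl) simp
qed (blast intro: word_eq.sym word_eq.trans)+

lemma word_eq_append:
  assumes "is_presentation P" "word_eq P a b" "word_eq P c d"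
  shows "word_eq P (a @ c) (b @ d)"
proof -
  have "word_eq P (a @ c) (b @ c)"
    using word_eq_context[OF assms(2), of "[]" c] word_eq_words[OF assms(1,3)] by simp
  moreover have "word_eq P (b @ c) (b @ d)"
    using word_eq_context[OF assms(3), of b "[]"] word_eq_words[OF assms(1,2)] by simp
  ultimately show ?thesis by (rule word_eq.trans)
qed

lemma word_class_eq_iff:
  assumes "w \<in> words (fst P)"
  shows "word_class P v = word_class P w \<longleftrightarrow> word_eq P v w"
  unfolding word_class_def
  using word_eq.refl[OF assms] word_eq.sym[of P] word_eq.trans[of P] by blast

lemma mult_word_class:
  assumes "is_presentation P" "v \<in> words (fst P)" "w \<in> words (fst P)"
  shows "word_class P v \<otimes>\<^bsub>presented_group P\<^esub> word_class P w = word_class P (v @ w)"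
proof -
  have vw: "v @ w \<in> words (fst P)"
    using assms by simp
  have "word_class P (a @ b) = word_class P (v @ w)"
    if "a \<in> word_class P v" "b \<in> word_class P w" for a b
  proof -
    have "word_eq P v a" "word_eq P w b"
      using that by (simp_all add: word_class_def)
    then have "word_eq P (a @ b) (v @ w)"
      by (intro word_eq.sym[OF word_eq_append[OF assms(1)]])
    then show ?thesis
      using word_class_eq_iff[OF vw] by blast
  qed
  moreover have "v \<in> word_class P v" "w \<in> word_class P w"
    using assms by (simp_all add: word_class_def word_eq.refl)
  ultimately have "(\<Union>a\<in>word_class P v. \<Union>b\<in>word_class P w. word_class P (a @ b)) = word_class P (v @ w)"
    by blast
  then show ?thesis
    by (simp add: presented_group_def)
qed

lemma word_eq_left_inverse:
  assumes "w \<in> words (fst P)"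
  shows "word_eq P (rev (map inv_letter w) @ w) []"
  using assms
proof (induction w)
  case (Cons x w)
  then have x: "x \<in> letters (fst P)" and w: "w \<in> words (fst P)"
    by auto
  have step: "word_eq P (rev (map inv_letter w) @ [inv_letter x, inv_letter (inv_letter x)] @ w)
          (rev (map inv_letter w) @ w)"
    using x w by (intro word_eq.cancel) auto
  show ?case using word_eq.trans[OF step Cons.IH[OF w]] by simp
qed (simp add: word_eq.refl)

lemma group_presented_group:
  assumes "is_presentation P"
  shows "group (presented_group P)"
proof (rule groupI)
  have carrier: "carrier (presented_group P) = word_class P ` words (fst P)"
    and one: "\<one>\<^bsub>presented_group P\<^esub> = word_class P []"
    by (simp_all add: presented_group_def)
  note simps = carrier one mult_word_class[OF assms]
  show "\<one>\<^bsub>presented_group P\<^esub> \<in> carrier (presented_group P)"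
    by (simp add: simps)
  fix A assume A: "A \<in> carrier (presented_group P)"
  then obtain a where a: "a \<in> words (fst P)" "A = word_class P a" by (auto simp: simps)
  show "\<one>\<^bsub>presented_group P\<^esub> \<otimes>\<^bsub>presented_group P\<^esub> A = A"
    using a by (simp add: simps)
  show "\<exists>B\<in>carrier (presented_group P). B \<otimes>\<^bsub>presented_group P\<^esub> A = \<one>\<^bsub>presented_group P\<^esub>"
    using a word_eq_left_inverse[of a P]
    by (intro bexI[of _ "word_class P (rev (map inv_letter a))"])
       (auto simp: simps word_class_eq_iff)
  fix B assume "B \<in> carrier (presented_group P)"
  then obtain b where b: "b \<in> words (fst P)" "B = word_class P b" by (auto simp: simps)
  show "A \<otimes>\<^bsub>presented_group P\<^esub> B \<in> carrier (presented_group P)"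
    using a b by (auto simp: simps)
  fix C assume "C \<in> carrier (presented_group P)"
  then obtain c where c: "c \<in> words (fst P)" "C = word_class P c" by (auto simp: simps)
  show "A \<otimes>\<^bsub>presented_group P\<^esub> B \<otimes>\<^bsub>presented_group P\<^esub> C
      = A \<otimes>\<^bsub>presented_group P\<^esub> (B \<otimes>\<^bsub>presented_group P\<^esub> C)"
    using a b c by (simp add: simps)
qed

section \<open>Partial recursive functions\<close>

text \<open>
  Programs for the partial recursive functions of one natural-number argument; several arguments
  are passed through the bijection \<^const>\<open>prod_encode\<close>. \<open>PrimRec f g\<close> computes
  \<open>h (a, 0) = f a\<close>, \<open>h (a, n + 1) = g (a, (n, h (a, n)))\<close>, and \<open>Minimize f\<close>
  maps \<open>a\<close> to the least \<open>n\<close> with \<open>f (a, n) = 0\<close>, provided that \<open>f (a, m)\<close>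
  is defined for all \<open>m < n\<close>.
\<close>

datatype prog =
    Zero
  | Succ
  | Proj1
  | Proj2
  | Tuple prog prog
  | Compose prog prog
  | PrimRec prog prog
  | Minimize prog

text \<open>\<open>eval c x y\<close>: the program \<open>c\<close> halts on input \<open>x\<close> with output \<open>y\<close>.\<close>

inductive eval :: "prog \<Rightarrow> nat \<Rightarrow> nat \<Rightarrow> bool" where
  Zero: "eval Zero x 0"
| Succ: "eval Succ x (Suc x)"
| Proj1: "eval Proj1 (prod_encode (x, y)) x"
| Proj2: "eval Proj2 (prod_encode (x, y)) y"
| Tuple: "eval f x y \<Longrightarrow> eval g x z \<Longrightarrow> eval (Tuple f g) x (prod_encode (y, z))"
| Compose: "eval g x y \<Longrightarrow> eval f y z \<Longrightarrow> eval (Compose f g) x z"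
| PrimRec_0: "eval f a y \<Longrightarrow> eval (PrimRec f g) (prod_encode (a, 0)) y"
| PrimRec_Suc: "eval (PrimRec f g) (prod_encode (a, n)) y \<Longrightarrow>
    eval g (prod_encode (a, prod_encode (n, y))) z \<Longrightarrow>
    eval (PrimRec f g) (prod_encode (a, Suc n)) z"
| Minimize: "eval f (prod_encode (a, n)) 0 \<Longrightarrow>
    \<forall>m<n. \<exists>y. eval f (prod_encode (a, m)) (Suc y) \<Longrightarrow>
    eval (Minimize f) a n"

lemma eval_deterministic: "eval c x y \<Longrightarrow> eval c x z \<Longrightarrow> y = z"
proof (induction arbitrary: z rule: eval.induct)
  case (Minimize f a n)
  from Minimize.prems obtain k where k: "z = k" "eval f (prod_encode (a, k)) 0"
    "\<forall>m<k. \<exists>y. eval f (prod_encode (a, m)) (Suc y)"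
    by cases auto
  have "\<not> k < n" using Minimize.IH(2) k(2) by fastforce
  moreover have "\<not> n < k" using Minimize.IH(1) k(3) by fastforce
  ultimately show ?case using k(1) by simp
next
  case (Zero x)
  then show ?case by cases auto
next
  case (Succ x)
  then show ?case by cases auto
next
  case (Proj1 x y)
  then show ?case by cases auto
next
  case (Proj2 x y)
  then show ?case by cases auto
next
  case (Compose g x y f z z')
  from Compose.prems show ?case by cases (use Compose.IH in blast)
next
  case (Tuple f x y g z z')
  from Tuple.prems show ?case by cases (use Tuple.IH in blast)
next
  case (PrimRec_Suc f g a n y z z')
  from PrimRec_Suc.prems show ?case by cases (use PrimRec_Suc.IH in auto)
next
  case (PrimRec_0 f a y g z)
  from PrimRec_0.prems show ?case by cases (use PrimRec_0.IH in auto)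
qed

primrec prog_code :: "prog \<Rightarrow> nat" where
  "prog_code Zero = 0"
| "prog_code Succ = 1"
| "prog_code Proj1 = 2"
| "prog_code Proj2 = 3"
| "prog_code (Tuple f g) = 4 + 4 * prod_encode (prog_code f, prog_code g)"
| "prog_code (Compose f g) = 5 + 4 * prod_encode (prog_code f, prog_code g)"
| "prog_code (PrimRec f g) = 6 + 4 * prod_encode (prog_code f, prog_code g)"
| "prog_code (Minimize f) = 7 + 4 * prog_code f"

lemma prog_code_inject: "prog_code c = prog_code d \<Longrightarrow> c = d"
proof (induction c arbitrary: d)
  case (Tuple f g)
  then show ?case by (cases d; simp; arith?)
next
  case (Compose f g)
  then show ?case by (cases d; simp; arith?)
next
  case (PrimRec f g)
  then show ?case by (cases d; simp; arith?)
next
  case (Minimize f)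
  then show ?case by (cases d; simp; arith?)
qed (case_tac d; simp)+

section \<open>Algorithms on presentations\<close>

fun letter_code :: "nat letter \<Rightarrow> nat" where
  "letter_code (Gen i) = 2 * i"
| "letter_code (Inv i) = 2 * i + 1"

definition word_code :: "nat letter list \<Rightarrow> nat" where
  "word_code w = list_encode (map letter_code w)"

text \<open>
  The machine \<open>e\<close> enumerates \<open>S\<close> if its outputs, over all inputs, are exactly the codes
  of the words in \<open>S\<close>. It may diverge on some or all inputs, so \<open>S\<close> may be any
  recursively enumerable set of words, including a finite or empty one.
\<close>

definition enumerates :: "prog \<Rightarrow> nat letter list set \<Rightarrow> bool" where
  "enumerates e S \<longleftrightarrow> {n. \<exists>i. eval e i n} = word_code ` S"

definition recursive_presentation :: "nat presentation \<Rightarrow> prog \<Rightarrow> bool" where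
  "recursive_presentation Q e \<longleftrightarrow>
    is_presentation Q \<and> finite (fst Q) \<and> enumerates e (snd Q)"

definition presentation_code :: "nat set \<Rightarrow> prog \<Rightarrow> nat" where
  "presentation_code Y e = prod_encode (set_encode Y, prog_code e)"

definition solves_word_problem :: "prog \<Rightarrow> nat presentation \<Rightarrow> bool" where
  "solves_word_problem c Q \<longleftrightarrow>
    (\<forall>w \<in> words (fst Q).
      eval c (word_code w) (if word_class Q w = \<one>\<^bsub>presented_group Q\<^esub> then 1 else 0))"

definition solvable_word_problem :: "nat presentation \<Rightarrow> bool" where
  "solvable_word_problem Q \<longleftrightarrow> (\<exists>c. solves_word_problem c Q)"

text \<open>
  Nothing is required of \<open>A\<close> on inputs that do not describe a recursive presentation of a
  group isomorphic to the one presented by \<open>P\<close>.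
\<close>

definition uniformly_solves_word_problem :: "prog \<Rightarrow> nat presentation \<Rightarrow> bool" where
  "uniformly_solves_word_problem A P \<longleftrightarrow>
    (\<forall>Q e. recursive_presentation Q e \<longrightarrow> presented_group P \<cong> presented_group Q \<longrightarrow>
      (\<exists>c. eval A (presentation_code (fst Q) e) (prog_code c) \<and> solves_word_problem c Q))"

end

theory Submission
  imports Defs
begin

text \<open>
  The endomorphism \<open>s \<mapsto> s\<close>, \<open>t \<mapsto> t\<^sup>2\<close> of \<open>BS(2,3)\<close> is
  surjective and its kernel is the normal closure of the nontrivial commutator of
  \<open>s\<inverse>ts\<close> and \<open>t\<close>; hence adding this commutator as a relator does not change the
  isomorphism type of the group. Let the \<open>x\<close>-th recursive presentation have the relator of
  \<open>BS(2,3)\<close>, and also the commutator if the program with code \<open>x\<close> halts on \<open>x\<close>. All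
  these presentations define \<open>BS(2,3)\<close>, but a uniform solution of their word problems, applied to
  the commutator, would decide the halting problem.

  Right multiplication on Britton normal forms is an action of \<open>BS(2,3)\<close> on a set of
  states; it solves the word problem and shows that the commutator is nontrivial.
\<close>

section \<open>A calculus of computable functions\<close>

text \<open>The inputs must present the same group whether or not the extra relator ever appears, so
  the group has to be isomorphic to a proper quotient of itself; in a Hopfian group a nontrivial
  extra relator would change the isomorphism type. The exponents 2 and 3 provide this. The image of
  the endomorphism contains \<open>t^2\<close> and its conjugate \<open>s^-1 t^2 s = t^3\<close>,
  hence also \<open>t\<close>. The commutator is sent to that of \<open>t^3\<close> and
  \<open>t^2\<close>, so it dies, although it survives in \<open>BS(2,3)\<close> because neither 2
  nor 3 divides 1. A universal program is needed twice: to express that the program coded by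
  \<open>x\<close> halts on \<open>x\<close>, and to run the solution that the assumed algorithm
  returns only as a code.\<close>

definition pfst :: "nat \<Rightarrow> nat" where "pfst n = fst (prod_decode n)"
definition psnd :: "nat \<Rightarrow> nat" where "psnd n = snd (prod_decode n)"

lemma pfst_prod_encode [simp]: "pfst (prod_encode (a, b)) = a"
  by (simp add: pfst_def)

lemma psnd_prod_encode [simp]: "psnd (prod_encode (a, b)) = b"
  by (simp add: psnd_def)

lemma prod_encode_pfst_psnd [simp]: "prod_encode (pfst n, psnd n) = n"
  by (simp add: pfst_def psnd_def)

text \<open>Components are bounded by the code of the pair. Consequently \<open>0\<close> codes the
  initial state \<open>(0, [])\<close>, and \<open>code_tl\<close> fixes the code of the empty
  list.\<close>

lemma pfst_0 [simp]: "pfst 0 = 0" and psnd_0 [simp]: "psnd 0 = 0"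
  by (metis le_zero_eq le_prod_encode_1 le_prod_encode_2 prod_encode_pfst_psnd)+

definition computable :: "(nat \<Rightarrow> nat) \<Rightarrow> bool" where
  "computable f \<longleftrightarrow> (\<exists>c. \<forall>x. eval c x (f x))"

definition computable2 :: "(nat \<Rightarrow> nat \<Rightarrow> nat) \<Rightarrow> bool" where
  "computable2 f \<longleftrightarrow> computable (\<lambda>z. f (pfst z) (psnd z))"

definition decidable :: "(nat \<Rightarrow> bool) \<Rightarrow> bool" where
  "decidable P \<longleftrightarrow> computable (\<lambda>x. of_bool (P x))"

definition decidable2 :: "(nat \<Rightarrow> nat \<Rightarrow> bool) \<Rightarrow> bool" where
  "decidable2 P \<longleftrightarrow> decidable (\<lambda>z. P (pfst z) (psnd z))"

named_theorems computable_intros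

lemma eval_Proj1_pfst: "eval Proj1 x (pfst x)"
  using eval.Proj1[of "pfst x" "psnd x"] by simp

lemma eval_Proj2_psnd: "eval Proj2 x (psnd x)"
  using eval.Proj2[of "pfst x" "psnd x"] by simp

lemma eval_identity: "eval (Tuple Proj1 Proj2) x x"
  using eval.Tuple[OF eval_Proj1_pfst eval_Proj2_psnd, of x] by simp

lemma computable_id [computable_intros]: "computable (\<lambda>x. x)"
  unfolding computable_def using eval_identity by blast

primrec const_prog :: "nat \<Rightarrow> prog" where
  "const_prog 0 = Zero"
| "const_prog (Suc n) = Compose Succ (const_prog n)"

lemma eval_const_prog: "eval (const_prog n) x n"
  by (induction n) (auto intro: eval.intros)

lemma computable_const [computable_intros]: "computable (\<lambda>x. n)"
  unfolding computable_def using eval_const_prog by blast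

lemma computable_comp:
  assumes "computable f" "computable g"
  shows "computable (\<lambda>x. f (g x))"
  using assms unfolding computable_def by (blast intro: eval.Compose)

lemma computable_prod_encode [computable_intros]:
  assumes "computable f" "computable g"
  shows "computable (\<lambda>x. prod_encode (f x, g x))"
  using assms unfolding computable_def by (blast intro: eval.Tuple)

lemma computable_pfst [computable_intros]: "computable f \<Longrightarrow> computable (\<lambda>x. pfst (f x))"
  by (rule computable_comp) (auto simp: computable_def intro: eval_Proj1_pfst)

lemma computable_psnd [computable_intros]: "computable f \<Longrightarrow> computable (\<lambda>x. psnd (f x))"
  by (rule computable_comp) (auto simp: computable_def intro: eval_Proj2_psnd)

lemma computable_Suc [computable_intros]: "computable f \<Longrightarrow> computable (\<lambda>x. Suc (f x))"
  by (rule computable_comp) (auto simp: computable_def intro: eval.Succ)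

lemma computable2_app:
  assumes "computable2 f" "computable a" "computable b"
  shows "computable (\<lambda>x. f (a x) (b x))"
  using computable_comp[of "\<lambda>z. f (pfst z) (psnd z)", OF _ computable_prod_encode[OF assms(2,3)]] assms(1)
  by (simp add: computable2_def)

lemma decidable_comp:
  assumes "decidable P" "computable a"
  shows "decidable (\<lambda>x. P (a x))"
  using assms computable_comp[of "\<lambda>x. of_bool (P x)" a] by (simp add: decidable_def)

lemma decidable2_app:
  assumes "decidable2 P" "computable a" "computable b"
  shows "decidable (\<lambda>x. P (a x) (b x))"
  using decidable_comp[of "\<lambda>z. P (pfst z) (psnd z)", OF _ computable_prod_encode[OF assms(2,3)]] assms(1)
  by (simp add: decidable2_def)

text \<open>The parameter \<open>e\<close> is handed to the step as well, so loop bodies may depend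
  on the environment. Addition, subtraction, multiplication, branching and bounded quantifiers all
  reduce to this rule.\<close>

lemma computable_rec_nat [computable_intros]:
  assumes "computable b" "computable (\<lambda>z. s (pfst z) (pfst (psnd z)) (psnd (psnd z)))" "computable k"
  shows "computable (\<lambda>e. rec_nat (b e) (s e) (k e))"
proof -
  obtain cb where cb: "\<And>x. eval cb x (b x)" using assms(1) by (auto simp: computable_def)
  obtain cs where cs: "\<And>z. eval cs z (s (pfst z) (pfst (psnd z)) (psnd (psnd z)))"
    using assms(2) by (auto simp: computable_def)
  have "eval (PrimRec cb cs) (prod_encode (e, n)) (rec_nat (b e) (s e) n)" for e n
  proof (induction n)
    case (Suc n)
    show ?case
      using eval.PrimRec_Suc[OF Suc cs] by simp
  qed (simp add: eval.PrimRec_0 cb)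
  then have "computable2 (\<lambda>e n. rec_nat (b e) (s e) n)"
    unfolding computable2_def computable_def by (metis prod_encode_pfst_psnd)
  from computable2_app[OF this computable_id assms(3)] show ?thesis .
qed

lemma computable_funpow [computable_intros]:
  assumes "computable (\<lambda>z. h (pfst z) (psnd z))" "computable k" "computable b"
  shows "computable (\<lambda>e. (h e ^^ k e) (b e))"
proof -
  have *: "(g ^^ n) x = rec_nat x (\<lambda>_ y. g y) n" for g :: "nat \<Rightarrow> nat" and n x
    by (induction n) auto
  have "computable (\<lambda>z. h (pfst z) (psnd (psnd z)))"
    using computable2_app[of h "pfst" "\<lambda>z. psnd (psnd z)"] assms(1)
    by (simp add: computable2_def computable_intros)
  then show ?thesis
    unfolding * using assms by (intro computable_intros)
qed

lemma computable_pred: "computable f \<Longrightarrow> computable (\<lambda>x. f x - 1)"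
proof -
  assume f: "computable f"
  have "f x - 1 = rec_nat 0 (\<lambda>n _. n) (f x)" for x
    by (cases "f x") auto
  then show ?thesis using f by (simp only:) (intro computable_intros)
qed

lemma computable_add [computable_intros]:
  assumes "computable f" "computable g"
  shows "computable (\<lambda>x. f x + g x)"
proof -
  have "m + n = rec_nat m (\<lambda>_ y. Suc y) n" for m n :: nat
    by (induction n) auto
  then show ?thesis using assms by (simp only:) (intro computable_intros)
qed

lemma computable_diff [computable_intros]:
  assumes "computable f" "computable g"
  shows "computable (\<lambda>x. f x - g x)"
proof -
  have "rec_nat (f x) (\<lambda>_ y. y - 1) n = f x - n" for x n
    by (induction n) auto
  moreover have "computable (\<lambda>x. rec_nat (f x) (\<lambda>_ y. y - 1) (g x))"
    using assms by (intro computable_intros computable_pred)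
  ultimately show ?thesis by simp
qed

lemma computable_mult [computable_intros]:
  assumes "computable f" "computable g"
  shows "computable (\<lambda>x. f x * g x)"
proof -
  have *: "m * n = rec_nat 0 (\<lambda>_ y. y + m) n" for m n :: nat
    by (induction n) auto
  have "computable (\<lambda>x. rec_nat 0 (\<lambda>_ y. y + f x) (g x))"
    using assms by (intro computable_intros computable_comp[OF assms(1)])
  then show ?thesis by (simp add: *)
qed

text \<open>Branching is a recursion of length 0 or 1. Both branches are total functions, so
  evaluating both is harmless.\<close>

lemma computable_if [computable_intros]:
  assumes "decidable P" "computable f" "computable g"
  shows "computable (\<lambda>x. if P x then f x else g x)"
proof -
  have *: "(if P x then f x else g x) = rec_nat (g x) (\<lambda>_ _. f x) (of_bool (P x))" for x
    by auto
  show ?thesis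
    unfolding * using assms unfolding decidable_def
    by (intro computable_intros computable_comp[OF assms(2)])
qed

section \<open>Decidable predicates and bounded quantifiers\<close>

lemma computable_of_bool [computable_intros]: "decidable P \<Longrightarrow> computable (\<lambda>x. of_bool (P x))"
  by (simp add: decidable_def)

lemma decidable_not [computable_intros]: "decidable P \<Longrightarrow> decidable (\<lambda>x. \<not> P x)"
  proof -
  assume P: "decidable P"
  have "computable (\<lambda>x. 1 - of_bool (P x))"
    using P by (intro computable_intros)
  moreover have "1 - of_bool (P x) = (of_bool (\<not> P x) :: nat)" for x by simp
  ultimately show ?thesis by (simp only: decidable_def)
qed

lemma decidable_conj [computable_intros]:
  "decidable P \<Longrightarrow> decidable Q \<Longrightarrow> decidable (\<lambda>x. P x \<and> Q x)"
  unfolding decidable_def[of "\<lambda>x. P x \<and> Q x"] of_bool_conj by (intro computable_intros)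

lemma decidable_disj [computable_intros]:
  "decidable P \<Longrightarrow> decidable Q \<Longrightarrow> decidable (\<lambda>x. P x \<or> Q x)"
  using decidable_not[OF decidable_conj[OF decidable_not decidable_not]] by simp

lemma decidable_imp [computable_intros]:
  "decidable P \<Longrightarrow> decidable Q \<Longrightarrow> decidable (\<lambda>x. P x \<longrightarrow> Q x)"
  unfolding imp_conv_disj by (intro computable_intros)

lemma decidable_if [computable_intros]:
  "decidable P \<Longrightarrow> decidable Q \<Longrightarrow> decidable R \<Longrightarrow> decidable (\<lambda>x. if P x then Q x else R x)"
  unfolding if_bool_eq_conj by (intro computable_intros)

lemma decidable_le [computable_intros]:
  assumes "computable f" "computable g"
  shows "decidable (\<lambda>x. f x \<le> g x)"
proof -
  have "of_bool (f x \<le> g x) = 1 - (f x - g x)" for x by auto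
  then show ?thesis unfolding decidable_def using assms by (simp only:) (intro computable_intros)
qed

lemma decidable_less [computable_intros]:
  assumes "computable f" "computable g"
  shows "decidable (\<lambda>x. f x < g x)"
  unfolding not_le[symmetric] using assms by (intro computable_intros)

lemma decidable_eq [computable_intros]:
  assumes "computable f" "computable g"
  shows "decidable (\<lambda>x. f x = g x)"
  unfolding eq_iff using assms by (intro computable_intros)

lemma decidable_ex_less [computable_intros]:
  assumes "decidable (\<lambda>z. P (pfst z) (psnd z))" "computable b"
  shows "decidable (\<lambda>e. \<exists>i<b e. P e i)"
proof -
  have *: "of_bool (\<exists>i<n. P e i) = rec_nat 0 (\<lambda>i y. if P e i then 1 else y) n" for e n
  proof (induction n)
    case (Suc n)
    show ?case unfolding old.nat.simps Suc[symmetric] by (auto simp: less_Suc_eq)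
  qed simp
  have "decidable (\<lambda>z. P (pfst z) (pfst (psnd z)))"
    using decidable2_app[of P pfst "\<lambda>z. pfst (psnd z)"] assms(1)
    by (simp add: decidable2_def computable_intros)
  then show ?thesis
    unfolding decidable_def[of "\<lambda>e. \<exists>i<b e. P e i"] * using assms(2) by (intro computable_intros)
qed

lemma decidable_all_less [computable_intros]:
  assumes "decidable (\<lambda>z. P (pfst z) (psnd z))" "computable b"
  shows "decidable (\<lambda>e. \<forall>i<b e. P e i)"
proof -
  have *: "(\<forall>i<b e. P e i) \<longleftrightarrow> \<not> (\<exists>i<b e. \<not> P e i)" for e by blast
  show ?thesis unfolding * using assms by (intro computable_intros)
qed

section \<open>Unbounded search and division by constants\<close>

lemma eval_Minimize_total_iff:
  assumes "\<And>z. eval c z (F z)"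
  shows "eval (Minimize c) a n \<longleftrightarrow>
    F (prod_encode (a, n)) = 0 \<and> (\<forall>m<n. F (prod_encode (a, m)) \<noteq> 0)"
proof
  assume "eval (Minimize c) a n"
  then show "F (prod_encode (a, n)) = 0 \<and> (\<forall>m<n. F (prod_encode (a, m)) \<noteq> 0)"
    by cases (use assms eval_deterministic in fastforce)
next
  assume "F (prod_encode (a, n)) = 0 \<and> (\<forall>m<n. F (prod_encode (a, m)) \<noteq> 0)"
  then show "eval (Minimize c) a n"
    using assms by (intro eval.Minimize) (metis, metis not0_implies_Suc)
qed

lemma decidable2_search:
  assumes "decidable2 P"
  obtains c where "\<And>a n. eval c a n \<longleftrightarrow> P a n \<and> (\<forall>m<n. \<not> P a m)"
proof -
  \<comment> \<open>\<open>Minimize\<close> stops at the value 0, hence the negation.\<close>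
  have "computable (\<lambda>z. of_bool (\<not> P (pfst z) (psnd z)))"
    using assms unfolding decidable2_def by (intro computable_intros)
  then obtain c where "\<And>z. eval c z (of_bool (\<not> P (pfst z) (psnd z)))"
    by (auto simp: computable_def)
  from that[OF eval_Minimize_total_iff[OF this, simplified]] show ?thesis .
qed

lemma computable_Least [computable_intros]:
  assumes "decidable (\<lambda>z. P (pfst z) (psnd z))" "\<And>e. \<exists>n. P e n"
  shows "computable (\<lambda>e. LEAST n. P e n)"
proof -
  obtain c where "\<And>a n. eval c a n \<longleftrightarrow> P a n \<and> (\<forall>m<n. \<not> P a m)"
    using decidable2_search assms(1) unfolding decidable2_def by blast
  moreover have "P e (LEAST n. P e n)" "\<forall>m<(LEAST n. P e n). \<not> P e m" for e
    using assms(2) LeastI_ex not_less_Least by metis+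
  ultimately show ?thesis unfolding computable_def by metis
qed

lemma computable_div [computable_intros]:
  assumes "computable f" "m > 0"
  shows "computable (\<lambda>x. f x div m)"
proof -
  have *: "n div m = (LEAST q. n < Suc q * m)" for n
  proof (rule Least_equality[symmetric])
    show "n < Suc (n div m) * m" using assms(2) dividend_less_div_times by auto
    show "n div m \<le> q" if "n < Suc q * m" for q
      using that assms(2) by (simp add: less_mult_imp_div_less less_Suc_eq_le[symmetric])
  qed
  have "\<exists>q. n < Suc q * m" for n
    using assms(2) by (intro exI[of _ n]) (cases m, auto)
  moreover have "computable (\<lambda>z. f (pfst z))"
    by (intro computable_intros computable_comp[OF assms(1)])
  ultimately show ?thesis unfolding * by (intro computable_intros)
qed

lemma computable_mod [computable_intros]:
  assumes "computable f" "m > 0"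
  shows "computable (\<lambda>x. f x mod m)"
  unfolding minus_div_mult_eq_mod[symmetric] using assms by (intro computable_intros)

section \<open>Lists of natural numbers\<close>

text \<open>\<open>list_encode\<close> sends \<open>[]\<close> to 0 and any other list to the
  successor of a pair.\<close>

definition code_hd :: "nat \<Rightarrow> nat" where "code_hd n = pfst (n - 1)"
definition code_tl :: "nat \<Rightarrow> nat" where "code_tl n = psnd (n - 1)"

lemma code_hd_list_encode [simp]: "code_hd (list_encode (x # xs)) = x"
  by (simp add: code_hd_def)

lemma code_tl_list_encode [simp]: "code_tl (list_encode xs) = list_encode (tl xs)"
  by (cases xs) (simp_all add: code_tl_def)

lemma computable_code_hd [computable_intros]: "computable f \<Longrightarrow> computable (\<lambda>x. code_hd (f x))"
  unfolding code_hd_def by (intro computable_intros)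

lemma computable_code_tl [computable_intros]: "computable f \<Longrightarrow> computable (\<lambda>x. code_tl (f x))"
  unfolding code_tl_def by (intro computable_intros)

lemma list_encode_eq_0 [simp]: "list_encode xs = 0 \<longleftrightarrow> xs = []"
  by (cases xs) auto

lemma funpow_code_tl [simp]: "(code_tl ^^ i) (list_encode xs) = list_encode (drop i xs)"
  by (induction i) (simp_all add: drop_Suc tl_drop)

lemma length_le_list_encode: "length xs \<le> list_encode xs"
proof (induction xs)
  case (Cons x xs)
  then show ?case using le_prod_encode_2[of "list_encode xs" x] by simp
qed simp

lemma mem_less_list_encode: "x \<in> set xs \<Longrightarrow> x < list_encode xs"
proof (induction xs)
  case (Cons y xs)
  then show ?case
    using le_prod_encode_1[of y "list_encode xs"] le_prod_encode_2[of "list_encode xs" y] by auto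
qed simp

text \<open>The code bounds the length, so it serves as a computable range for the index; the test
  for nonzero discards indices past the end.\<close>

lemma all_suffix_iff:
  "(\<forall>i<list_encode xs. (code_tl ^^ i) (list_encode xs) \<noteq> 0 \<longrightarrow> P ((code_tl ^^ i) (list_encode xs))) \<longleftrightarrow>
    (\<forall>i<length xs. P (list_encode (drop i xs)))"
  using length_le_list_encode[of xs] by (auto simp: not_le)

lemma all_set_iff_suffix:
  "(\<forall>x\<in>set xs. P x) \<longleftrightarrow> (\<forall>i<length xs. P (code_hd (list_encode (drop i xs))))"
  by (auto simp: all_set_conv_all_nth Cons_nth_drop_Suc[symmetric] simp del: list_encode.simps)

lemma mem_list_decode_iff:
  "x \<in> set (list_decode L) \<longleftrightarrow> (\<exists>i<L. (code_tl ^^ i) L \<noteq> 0 \<and> code_hd ((code_tl ^^ i) L) = x)"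
  using all_suffix_iff[of "list_decode L" "\<lambda>M. code_hd M \<noteq> x"]
    all_set_iff_suffix[of "list_decode L" "\<lambda>y. y \<noteq> x"]
  by auto

lemma decidable_mem_list_decode [computable_intros]:
  assumes "computable f" "computable g"
  shows "decidable (\<lambda>x. f x \<in> set (list_decode (g x)))"
proof -
  have "decidable2 (\<lambda>x L. x \<in> set (list_decode L))"
    unfolding decidable2_def mem_list_decode_iff by (intro computable_intros)
  from decidable2_app[OF this assms] show ?thesis .
qed

section \<open>A universal program\<close>

text \<open>
  A halting computation is certified by a list of entries, each of which asserts a single evaluation
  and is justified by entries further down the list. Being a certificate is decidable, so
  unbounded search for a certificate yields a universal program.
\<close>

definition entry :: "nat \<Rightarrow> nat \<Rightarrow> nat \<Rightarrow> nat" where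
  "entry c x y = prod_encode (c, prod_encode (x, y))"

lemma entry_inject [simp]: "entry c x y = entry c' x' y' \<longleftrightarrow> c = c' \<and> x = x' \<and> y = y'"
  by (auto simp: entry_def)

lemma le_entry: "y \<le> entry c x y"
  unfolding entry_def by (meson le_prod_encode_2 le_trans)

lemma computable_entry [computable_intros]:
  "computable f \<Longrightarrow> computable g \<Longrightarrow> computable h \<Longrightarrow> computable (\<lambda>z. entry (f z) (g z) (h z))"
  unfolding entry_def by (intro computable_intros)

text \<open>For \<open>c \<ge> 4\<close> the number \<open>c div 4 - 1\<close> holds the codes of the immediate subprograms of
  the program with code \<open>c\<close>.\<close>

definition justified :: "nat set \<Rightarrow> nat \<Rightarrow> nat \<Rightarrow> nat \<Rightarrow> bool" where
  "justified S c x y \<longleftrightarrow>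
    (if c < 4 then
       y = (if c = 0 then 0 else if c = 1 then Suc x else if c = 2 then pfst x else psnd x)
     else if c mod 4 = 0 then
       entry (pfst (c div 4 - 1)) x (pfst y) \<in> S \<and> entry (psnd (c div 4 - 1)) x (psnd y) \<in> S
     else if c mod 4 = 1 then
       (\<exists>z. entry (psnd (c div 4 - 1)) x z \<in> S \<and> entry (pfst (c div 4 - 1)) z y \<in> S)
     else if c mod 4 = 2 then
       (if psnd x = 0 then entry (pfst (c div 4 - 1)) (pfst x) y \<in> S
        else \<exists>z. entry c (prod_encode (pfst x, psnd x - 1)) z \<in> S \<and>
          entry (psnd (c div 4 - 1)) (prod_encode (pfst x, prod_encode (psnd x - 1, z))) y \<in> S)
     else
       entry (c div 4 - 1) (prod_encode (x, y)) 0 \<in> S \<and>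
       (\<forall>m<y. \<exists>z. entry (c div 4 - 1) (prod_encode (x, m)) (Suc z) \<in> S))"

lemma mod_4_add: "(6 + 4 * n) mod 4 = 2" "(7 + 4 * n) mod 4 = (3::nat)"
  by presburger+

lemma div_4_add: "(4 + 4 * n) div 4 = Suc n" "(5 + 4 * n) div 4 = Suc n" "(6 + 4 * n) div 4 = Suc n"
    "(7 + 4 * n) div 4 = Suc (n :: nat)"
  by presburger+

text \<open>Stated with \<open>prog_code\<close> folded; later proofs remove
  \<open>prog_code.simps\<close> from the simplifier so that these rules apply.\<close>

lemma justified_prog_code [simp]:
  "justified S (prog_code Zero) x y \<longleftrightarrow> y = 0"
  "justified S (prog_code Succ) x y \<longleftrightarrow> y = Suc x"
  "justified S (prog_code Proj1) x y \<longleftrightarrow> y = pfst x"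
  "justified S (prog_code Proj2) x y \<longleftrightarrow> y = psnd x"
  "justified S (prog_code (Tuple f g)) x y \<longleftrightarrow>
    entry (prog_code f) x (pfst y) \<in> S \<and> entry (prog_code g) x (psnd y) \<in> S"
  "justified S (prog_code (Compose f g)) x y \<longleftrightarrow>
    (\<exists>z. entry (prog_code g) x z \<in> S \<and> entry (prog_code f) z y \<in> S)"
  "justified S (prog_code (PrimRec f g)) x y \<longleftrightarrow>
    (if psnd x = 0 then entry (prog_code f) (pfst x) y \<in> S
     else \<exists>z. entry (prog_code (PrimRec f g)) (prod_encode (pfst x, psnd x - 1)) z \<in> S \<and>
       entry (prog_code g) (prod_encode (pfst x, prod_encode (psnd x - 1, z))) y \<in> S)"
  "justified S (prog_code (Minimize f)) x y \<longleftrightarrow>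
    entry (prog_code f) (prod_encode (x, y)) 0 \<in> S \<and>
    (\<forall>m<y. \<exists>z. entry (prog_code f) (prod_encode (x, m)) (Suc z) \<in> S)"
  by (simp_all add: justified_def mod_4_add div_4_add)

text \<open>\<open>S\<close> occurs only positively. This is what allows certificates to be
  concatenated.\<close>

lemma justified_mono: "justified S c x y \<Longrightarrow> S \<subseteq> T \<Longrightarrow> justified T c x y"
  unfolding justified_def by (simp split: if_splits) blast+

text \<open>Members of a coded list are smaller than its code, and an output is at most its entry,
  so the search for an intermediate value is bounded and hence decidable.\<close>

lemma ex_entry_bounded:
  "(\<exists>z. entry c x z \<in> set (list_decode L) \<and> R z) \<longleftrightarrow>
    (\<exists>z<L. entry c x z \<in> set (list_decode L) \<and> R z)"
proof -
  have "z < L" if "entry c x z \<in> set (list_decode L)" for z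
    using mem_less_list_encode[OF that] le_entry[of z c x] by simp
  then show ?thesis by blast
qed

lemma ex_entry_Suc_bounded:
  "(\<exists>z. entry c x (Suc z) \<in> set (list_decode L)) \<longleftrightarrow>
    (\<exists>z<L. entry c x (Suc z) \<in> set (list_decode L))"
proof -
  have "z < L" if "entry c x (Suc z) \<in> set (list_decode L)" for z
    using mem_less_list_encode[OF that] le_entry[of "Suc z" c x] by simp
  then show ?thesis by blast
qed

lemma decidable_justified:
  assumes "computable L" "computable c" "computable x" "computable y"
  shows "decidable (\<lambda>e. justified (set (list_decode (L e))) (c e) (x e) (y e))"
proof -
  define J where "J L e = justified (set (list_decode L)) (pfst e) (pfst (psnd e)) (psnd (psnd e))" for L e
  have "decidable2 J"
    unfolding decidable2_def J_def justified_def ex_entry_bounded ex_entry_Suc_bounded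
    by (intro computable_intros zero_less_numeral)
  from decidable2_app[OF this assms(1) computable_entry[OF assms(2-4)]]
  show ?thesis by (simp add: J_def entry_def)
qed

section \<open>Certificates of halting computations\<close>

inductive certificate :: "nat list \<Rightarrow> bool" where
  Nil: "certificate []"
| Cons: "certificate xs \<Longrightarrow> justified (set xs) c x y \<Longrightarrow> certificate (entry c x y # xs)"

lemma certificate_append: "certificate xs \<Longrightarrow> certificate ys \<Longrightarrow> certificate (xs @ ys)"
proof (induction rule: certificate.induct)
  case (Cons xs c x y)
  then show ?case by (auto intro!: certificate.Cons elim: justified_mono)
qed simp

lemma entry_surj: "entry (pfst e) (pfst (psnd e)) (psnd (psnd e)) = e"
  by (simp add: entry_def)

lemma certificate_Cons_iff:
  "certificate (e # xs) \<longleftrightarrow> justified (set xs) (pfst e) (pfst (psnd e)) (psnd (psnd e)) \<and> certificate xs"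
  by (subst certificate.simps)
    (metis entry_def list.distinct(1) list.inject entry_surj pfst_prod_encode psnd_prod_encode)

lemma certificate_iff:
  "certificate xs \<longleftrightarrow> (\<forall>i<length xs. justified (set (drop (Suc i) xs))
    (pfst (xs ! i)) (pfst (psnd (xs ! i))) (psnd (psnd (xs ! i))))"
proof (induction xs)
  case (Cons e xs)
  then show ?case unfolding certificate_Cons_iff by (auto simp: less_Suc_eq_0_disj)
qed (simp add: certificate.Nil)

lemma decidable_certificate: "decidable (\<lambda>L. certificate (list_decode L))"
proof -
  define J where "J M = justified (set (list_decode (code_tl M)))
    (pfst (code_hd M)) (pfst (psnd (code_hd M))) (psnd (psnd (code_hd M)))" for M
  have "decidable J"
    unfolding J_def by (intro decidable_justified computable_intros)
  have "certificate (list_decode L) \<longleftrightarrow> (\<forall>i<L. (code_tl ^^ i) L \<noteq> 0 \<longrightarrow> J ((code_tl ^^ i) L))" for L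
  proof -
    have "J (list_encode (drop i (list_decode L))) \<longleftrightarrow>
       justified (set (drop (Suc i) (list_decode L))) (pfst (list_decode L ! i))
         (pfst (psnd (list_decode L ! i))) (psnd (psnd (list_decode L ! i)))"
      if "i < length (list_decode L)" for i
      unfolding J_def using that by (simp add: Cons_nth_drop_Suc[symmetric] del: list_encode.simps)
    then show ?thesis
      using all_suffix_iff[of "list_decode L" J] by (simp add: certificate_iff)
  qed
  then show ?thesis
    by (simp only:) (intro computable_intros decidable_comp[OF \<open>decidable J\<close>])
qed

text \<open>The head entry is justified by the tail alone, so the induction hypothesis supplies
  exactly the premises of the matching rule of \<open>eval\<close>.\<close>

lemma certificate_sound:
  "certificate xs \<Longrightarrow> entry (prog_code c) x y \<in> set xs \<Longrightarrow> eval c x y"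
proof (induction arbitrary: c x y rule: certificate.induct)
  case (Cons xs c' x' y')
  show ?case
  proof (cases "entry (prog_code c) x y \<in> set xs")
    case False
    then have just: "justified (set xs) (prog_code c) x y"
      using Cons.hyps(2) Cons.prems by auto
    note IH = Cons.IH
    show ?thesis
    proof (cases c)
      case (Tuple f g)
      then show ?thesis
        using just IH eval.Tuple[of f x "pfst y" g "psnd y"] by (simp del: prog_code.simps)
    next
      case (Compose f g)
      then show ?thesis using just IH by (auto simp del: prog_code.simps intro: eval.Compose)
    next
      case (PrimRec f g)
      obtain a n where x: "x = prod_encode (a, n)" by (metis prod_encode_pfst_psnd)
      show ?thesis
      proof (cases n)
        case 0
        then show ?thesis using just IH x PrimRec by (simp del: prog_code.simps add: eval.PrimRec_0)
      next
        case (Suc m)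
        then show ?thesis using just IH x PrimRec
          by (auto simp del: prog_code.simps intro: eval.PrimRec_Suc)
      qed
    next
      case (Minimize f)
      then show ?thesis using just IH by (simp del: prog_code.simps) (meson eval.Minimize)
    qed (use just in \<open>auto simp del: prog_code.simps intro: eval.Zero eval.Succ eval_Proj1_pfst eval_Proj2_psnd\<close>)
  qed (use Cons.IH in blast)
qed simp

lemma certificate_covers:
  assumes "finite E" "\<And>e. e \<in> E \<Longrightarrow> \<exists>xs. certificate xs \<and> e \<in> set xs"
  shows "\<exists>xs. certificate xs \<and> E \<subseteq> set xs"
  using assms
proof (induction E rule: finite_induct)
  case (insert e E)
  then obtain xs ys where "certificate xs" "E \<subseteq> set xs" "certificate ys" "e \<in> set ys"
    by (metis insertCI)
  then show ?case
    using certificate_append[of xs ys] by (intro exI[of _ "xs @ ys"]) auto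
qed (auto intro: certificate.Nil)

text \<open>The common step of completeness: finitely many premises, each with a certificate of its
  own, are merged before the conclusion is put on top.\<close>

lemma certificate_extend:
  assumes "finite E" "\<And>e. e \<in> E \<Longrightarrow> \<exists>xs. certificate xs \<and> e \<in> set xs" "justified E c x y"
  shows "\<exists>xs. certificate xs \<and> entry c x y \<in> set xs"
proof -
  obtain xs where "certificate xs" "E \<subseteq> set xs"
    using certificate_covers[OF assms(1,2)] by blast
  then have "certificate (entry c x y # xs)"
    by (meson certificate.Cons justified_mono assms(3))
  then show ?thesis by (intro exI[of _ "entry c x y # xs"]) simp
qed

lemma certificate_complete:
  "eval c x y \<Longrightarrow> \<exists>xs. certificate xs \<and> entry (prog_code c) x y \<in> set xs"
proof (induction rule: eval.induct)
  case (Tuple f x y g z)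
  then show ?case
    by (intro certificate_extend[of "{entry (prog_code f) x y, entry (prog_code g) x z}"])
       (auto simp del: prog_code.simps)
next
  case (Compose g x y f z)
  then show ?case
    by (intro certificate_extend[of "{entry (prog_code g) x y, entry (prog_code f) y z}"])
       (auto simp del: prog_code.simps)
next
  case (PrimRec_0 f a y g)
  then show ?case
    by (intro certificate_extend[of "{entry (prog_code f) a y}"]) (auto simp del: prog_code.simps)
next
  case (PrimRec_Suc f g a n y z)
  then show ?case
    by (intro certificate_extend[of "{entry (prog_code (PrimRec f g)) (prod_encode (a, n)) y,
        entry (prog_code g) (prod_encode (a, prod_encode (n, y))) z}"])
       (auto simp del: prog_code.simps)
next
  case (Minimize f a n)
  \<comment> \<open>Choosing all outputs \<open>Suc (Y m)\<close> at once turns the premises of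
    minimization into a finite set of entries.\<close>
  then obtain Y where Y: "\<And>m. m < n \<Longrightarrow>
    \<exists>xs. certificate xs \<and> entry (prog_code f) (prod_encode (a, m)) (Suc (Y m)) \<in> set xs"
    by metis
  show ?case
    by (intro certificate_extend[of "insert (entry (prog_code f) (prod_encode (a, n)) 0)
        ((\<lambda>m. entry (prog_code f) (prod_encode (a, m)) (Suc (Y m))) ` {..<n})"])
       (use Y Minimize.IH in \<open>auto simp del: prog_code.simps\<close>)
qed (rule certificate_extend[of "{}"]; simp del: prog_code.simps)+

inductive_simps eval_Compose_iff: "eval (Compose f g) x z"

lemma universal_program:
  obtains U where "\<And>c x y. eval U (prod_encode (prog_code c, x)) y \<longleftrightarrow> eval c x y"
proof -
  \<comment> \<open>The searched number \<open>n\<close> pairs a certificate with the claimed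
    output, which \<open>Proj2\<close> then reads off.\<close>
  define P where "P a n \<longleftrightarrow> certificate (list_decode (pfst n)) \<and>
    entry (pfst a) (psnd a) (psnd n) \<in> set (list_decode (pfst n))" for a n
  have "decidable2 P"
    unfolding decidable2_def P_def by (intro computable_intros decidable_comp[OF decidable_certificate])
  then obtain p where p: "\<And>a n. eval p a n \<longleftrightarrow> P a n \<and> (\<forall>m<n. \<not> P a m)"
    using decidable2_search by blast
  have Proj2: "eval Proj2 x y \<longleftrightarrow> y = psnd x" for x y
    using eval_Proj2_psnd eval_deterministic by blast
  have "eval (Compose Proj2 p) (prod_encode (prog_code c, x)) y \<longleftrightarrow> eval c x y" for c x y
  proof
    assume "eval (Compose Proj2 p) (prod_encode (prog_code c, x)) y"
    then show "eval c x y"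
      using certificate_sound by (auto simp: eval_Compose_iff p P_def Proj2)
  next
    assume c: "eval c x y"
    let ?P = "P (prod_encode (prog_code c, x))"
    obtain xs where "certificate xs" "entry (prog_code c) x y \<in> set xs"
      using certificate_complete[OF c] by blast
    then have "?P (prod_encode (list_encode xs, y))" by (simp add: P_def)
    then have least: "?P (Least ?P)" by (rule LeastI)
    \<comment> \<open>The least hit may use another certificate, but determinism fixes the
      output.\<close>
    then have "eval c x (psnd (Least ?P))"
      using certificate_sound by (auto simp: P_def)
    then have "psnd (Least ?P) = y" using c eval_deterministic by blast
    moreover have "eval p (prod_encode (prog_code c, x)) (Least ?P)"
      using least not_less_Least by (auto simp: p)
    ultimately show "eval (Compose Proj2 p) (prod_encode (prog_code c, x)) y"
      by (auto simp: eval_Compose_iff Proj2)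
  qed
  then show ?thesis using that by blast
qed

section \<open>Values of words in a group\<close>

fun letter_val :: "('b, 'm) monoid_scheme \<Rightarrow> ('a \<Rightarrow> 'b) \<Rightarrow> 'a letter \<Rightarrow> 'b" where
  "letter_val G \<phi> (Gen a) = \<phi> a"
| "letter_val G \<phi> (Inv a) = inv\<^bsub>G\<^esub> (\<phi> a)"

primrec word_val :: "('b, 'm) monoid_scheme \<Rightarrow> ('a \<Rightarrow> 'b) \<Rightarrow> 'a letter list \<Rightarrow> 'b" where
  "word_val G \<phi> [] = \<one>\<^bsub>G\<^esub>"
| "word_val G \<phi> (x # w) = letter_val G \<phi> x \<otimes>\<^bsub>G\<^esub> word_val G \<phi> w"

lemma Gen_in_letters [simp]: "Gen a \<in> letters Y \<longleftrightarrow> a \<in> Y"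
  and Inv_in_letters [simp]: "Inv a \<in> letters Y \<longleftrightarrow> a \<in> Y"
  by (auto simp: letters_def)

lemma (in group) letter_val_closed:
  "\<phi> \<in> Y \<rightarrow> carrier G \<Longrightarrow> x \<in> letters Y \<Longrightarrow> letter_val G \<phi> x \<in> carrier G"
  by (cases x) (auto simp: letters_def)

lemma (in group) word_val_closed:
  "\<phi> \<in> Y \<rightarrow> carrier G \<Longrightarrow> w \<in> words Y \<Longrightarrow> word_val G \<phi> w \<in> carrier G"
  by (induction w) (auto simp: letter_val_closed)

lemma (in group) word_val_append:
  "\<phi> \<in> Y \<rightarrow> carrier G \<Longrightarrow> v \<in> words Y \<Longrightarrow> w \<in> words Y \<Longrightarrow>
    word_val G \<phi> (v @ w) = word_val G \<phi> v \<otimes> word_val G \<phi> w"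
  by (induction v) (auto simp: letter_val_closed word_val_closed m_assoc)

lemma (in group) letter_val_inv_letter:
  "\<phi> \<in> Y \<rightarrow> carrier G \<Longrightarrow> x \<in> letters Y \<Longrightarrow>
    letter_val G \<phi> x \<otimes> letter_val G \<phi> (inv_letter x) = \<one>"
  by (cases x) (auto simp: letters_def Pi_iff)

text \<open>The core of von Dyck's theorem: each generating step of the congruence preserves the
  value.\<close>

lemma (in group) word_val_eq_if_word_eq:
  assumes "is_presentation P" "\<phi> \<in> fst P \<rightarrow> carrier G" "\<And>r. r \<in> snd P \<Longrightarrow> word_val G \<phi> r = \<one>"
    and "word_eq P v w"
  shows "word_val G \<phi> v = word_val G \<phi> w"
  using assms(4)
proof induction
  case (cancel u v x)
  have "letter_val G \<phi> x \<otimes> (letter_val G \<phi> (inv_letter x) \<otimes> word_val G \<phi> v) = word_val G \<phi> v"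
    using letter_val_inv_letter[OF assms(2), of x] cancel assms(2)
    by (simp add: m_assoc[symmetric] letter_val_closed word_val_closed)
  then show ?case
    using cancel assms(2) by (simp add: word_val_append[where Y = "fst P"])
next
  case (relator u v r)
  then have "r \<in> words (fst P)" using assms(1) by (auto simp: is_presentation_def)
  then show ?case
    using relator assms(2,3) by (simp add: word_val_append[where Y = "fst P"] word_val_closed)
qed auto

section \<open>Generators of presented groups and induced homomorphisms\<close>

lemma carrier_presented_group: "carrier (presented_group P) = word_class P ` words (fst P)"
  and one_presented_group: "\<one>\<^bsub>presented_group P\<^esub> = word_class P []"
  by (simp_all add: presented_group_def)

definition gen_class :: "'a presentation \<Rightarrow> 'a \<Rightarrow> 'a letter list set" where
  "gen_class P a = word_class P [Gen a]"

lemma gen_class_closed: "gen_class P \<in> fst P \<rightarrow> carrier (presented_group P)"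
  unfolding gen_class_def carrier_presented_group by auto

lemma inv_gen_class:
  assumes "is_presentation P" "a \<in> fst P"
  shows "inv\<^bsub>presented_group P\<^esub> (gen_class P a) = word_class P [Inv a]"
proof (rule group.inv_equality[OF group_presented_group[OF assms(1)]])
  have "word_eq P ([] @ [Inv a, inv_letter (Inv a)] @ []) ([] @ [])"
    using assms by (intro word_eq.cancel) (auto simp: letters_def)
  then have "word_eq P [Inv a, Gen a] []" by simp
  then show "word_class P [Inv a] \<otimes>\<^bsub>presented_group P\<^esub> gen_class P a = \<one>\<^bsub>presented_group P\<^esub>"
    unfolding gen_class_def using assms
    by (simp add: mult_word_class one_presented_group word_class_eq_iff)
  show "gen_class P a \<in> carrier (presented_group P)"
    using gen_class_closed[of P] assms by blast
  show "word_class P [Inv a] \<in> carrier (presented_group P)"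
    using assms by (auto simp: carrier_presented_group)
qed

lemma word_val_gen_class:
  assumes "is_presentation P" "w \<in> words (fst P)"
  shows "word_val (presented_group P) (gen_class P) w = word_class P w"
  using assms(2)
proof (induction w)
  case (Cons x w)
  have "letter_val (presented_group P) (gen_class P) x = word_class P [x]"
    using Cons.prems inv_gen_class[OF assms(1)] by (cases x) (auto simp: gen_class_def letters_def)
  then show ?case
    using Cons mult_word_class[OF assms(1), of "[x]" w] by simp
qed (simp add: one_presented_group)

text \<open>When the relators hold in \<open>G\<close>, \<open>word_val\<close> is constant on each
  class, so the image is a singleton.\<close>

definition induced_hom :: "('b, 'm) monoid_scheme \<Rightarrow> ('a \<Rightarrow> 'b) \<Rightarrow> 'a letter list set \<Rightarrow> 'b" where
  "induced_hom G \<phi> C = the_elem (word_val G \<phi> ` C)"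

lemma (in group) induced_hom_word_class:
  assumes "is_presentation P" "\<phi> \<in> fst P \<rightarrow> carrier G" "\<And>r. r \<in> snd P \<Longrightarrow> word_val G \<phi> r = \<one>"
    and "w \<in> words (fst P)"
  shows "induced_hom G \<phi> (word_class P w) = word_val G \<phi> w"
proof -
  have "word_val G \<phi> ` word_class P w = {word_val G \<phi> w}"
  proof -
    have "word_val G \<phi> v = word_val G \<phi> w" if "v \<in> word_class P w" for v
      using that word_val_eq_if_word_eq[OF assms(1-3), of w v] by (simp add: word_class_def)
    moreover have "w \<in> word_class P w"
      using word_eq.refl[OF assms(4)] by (simp add: word_class_def)
    ultimately show ?thesis by blast
  qed
  then show ?thesis by (simp add: induced_hom_def)
qed

lemma (in group) induced_hom_gen_class:
  assumes "is_presentation P" "\<phi> \<in> fst P \<rightarrow> carrier G" "\<And>r. r \<in> snd P \<Longrightarrow> word_val G \<phi> r = \<one>"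
    and "a \<in> fst P"
  shows "induced_hom G \<phi> (gen_class P a) = \<phi> a"
  unfolding gen_class_def using induced_hom_word_class[OF assms(1-3), of "[Gen a]"] assms(2,4)
  by (auto simp: Pi_iff)

lemma (in group) induced_hom_hom:
  assumes "is_presentation P" "\<phi> \<in> fst P \<rightarrow> carrier G" "\<And>r. r \<in> snd P \<Longrightarrow> word_val G \<phi> r = \<one>"
  shows "induced_hom G \<phi> \<in> hom (presented_group P) G"
  by (rule homI)
    (auto simp: carrier_presented_group mult_word_class[OF assms(1)] induced_hom_word_class[OF assms]
      word_val_closed[OF assms(2)] word_val_append[OF assms(2)])

lemma hom_word_val:
  assumes "group G" "group H" "h \<in> hom G H" "\<phi> \<in> Y \<rightarrow> carrier G" "w \<in> words Y"
  shows "h (word_val G \<phi> w) = word_val H (\<lambda>a. h (\<phi> a)) w"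
proof -
  interpret group_hom G H h using assms(1-3) by (simp add: group_hom_def group_hom_axioms_def)
  have "h (letter_val G \<phi> x) = letter_val H (\<lambda>a. h (\<phi> a)) x" if "x \<in> letters Y" for x
    using that assms(4) by (cases x) (auto simp: letters_def Pi_iff)
  then show ?thesis
    using assms(5)
    by (induction w) (auto simp: G.letter_val_closed[OF assms(4)] G.word_val_closed[OF assms(4)])
qed

lemma word_val_cong:
  "(\<And>a. a \<in> Y \<Longrightarrow> \<phi> a = \<psi> a) \<Longrightarrow> w \<in> words Y \<Longrightarrow> word_val G \<phi> w = word_val G \<psi> w"
proof (induction w)
  case (Cons x w)
  then show ?case by (cases x) (auto simp: letters_def)
qed simp

text \<open>Every element is the value of a word in the generator classes, and homomorphisms commute
  with taking values.\<close>

lemma hom_presented_group_id: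
  assumes "is_presentation P" "h \<in> hom (presented_group P) (presented_group P)"
    and "\<And>a. a \<in> fst P \<Longrightarrow> h (gen_class P a) = gen_class P a"
    and "x \<in> carrier (presented_group P)"
  shows "h x = x"
proof -
  obtain w where w: "w \<in> words (fst P)" "x = word_class P w"
    using assms(4) by (auto simp: carrier_presented_group)
  note G = group_presented_group[OF assms(1)]
  have "h (word_val (presented_group P) (gen_class P) w) = word_val (presented_group P) (gen_class P) w"
    unfolding hom_word_val[OF G G assms(2) gen_class_closed w(1)]
    by (rule word_val_cong[of "fst P"]) (use assms(3) w(1) in auto)
  then show ?thesis using w word_val_gen_class[OF assms(1)] by simp
qed

lemma presented_group_iso:
  assumes "is_presentation P" "is_presentation Q"
    and f: "f \<in> hom (presented_group P) (presented_group Q)"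
    and g: "g \<in> hom (presented_group Q) (presented_group P)"
    and gf: "\<And>a. a \<in> fst P \<Longrightarrow> g (f (gen_class P a)) = gen_class P a"
    and fg: "\<And>a. a \<in> fst Q \<Longrightarrow> f (g (gen_class Q a)) = gen_class Q a"
  shows "presented_group P \<cong> presented_group Q"
proof -
  have "g \<circ> f \<in> hom (presented_group P) (presented_group P)"
    "f \<circ> g \<in> hom (presented_group Q) (presented_group Q)"
    using hom_compose[OF f g] hom_compose[OF g f] by simp_all
  then have "\<And>x. x \<in> carrier (presented_group P) \<Longrightarrow> g (f x) = x"
    "\<And>x. x \<in> carrier (presented_group Q) \<Longrightarrow> f (g x) = x"
    using hom_presented_group_id[OF assms(1), of "g \<circ> f"] gf
      hom_presented_group_id[OF assms(2), of "f \<circ> g"] fg by auto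
  then have "bij_betw f (carrier (presented_group P)) (carrier (presented_group Q))"
    using f g by (intro bij_betw_byWitness[where f' = g]) (auto simp: hom_def)
  then show ?thesis using f by (auto simp: is_iso_def iso_def)
qed

section \<open>A quotient of \<open>BS(2,3)\<close> isomorphic to \<open>BS(2,3)\<close>\<close>

definition (in group) conj_by :: "'a \<Rightarrow> 'a \<Rightarrow> 'a" where
  "conj_by s x = inv s \<otimes> x \<otimes> s"

lemma (in group) conj_by_closed [simp]:
  "s \<in> carrier G \<Longrightarrow> x \<in> carrier G \<Longrightarrow> conj_by s x \<in> carrier G"
  by (simp add: conj_by_def)

lemma (in group) conj_by_mult:
  "s \<in> carrier G \<Longrightarrow> x \<in> carrier G \<Longrightarrow> y \<in> carrier G \<Longrightarrow>
    conj_by s (x \<otimes> y) = conj_by s x \<otimes> conj_by s y"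
  by (simp add: conj_by_def m_assoc inv_solve_left' flip: m_assoc[of s "inv s"])

definition bs_relator :: "nat letter list" where
  "bs_relator = [Inv 0, Gen 1, Gen 1, Gen 0, Inv 1, Inv 1, Inv 1]"

lemma BS_2_3: "BS 2 3 = ({0, 1}, {bs_relator})"
  by (simp add: BS_def bs_relator_def numeral_eq_Suc)

lemma fst_BS [simp]: "fst (BS 2 3) = {0, 1}" and snd_BS [simp]: "snd (BS 2 3) = {bs_relator}"
  by (simp_all add: BS_2_3)

text \<open>The commutator of \<open>s\<inverse>ts\<close> and \<open>t\<close>.\<close>

definition kernel_word :: "nat letter list" where
  "kernel_word = [Inv 0, Gen 1, Gen 0, Gen 1, Inv 0, Inv 1, Gen 0, Inv 1]"

definition BS_quot :: "nat presentation" where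
  "BS_quot = ({0, 1}, {bs_relator, kernel_word})"

lemma fst_BS_quot [simp]: "fst BS_quot = {0, 1}"
  and snd_BS_quot [simp]: "snd BS_quot = {bs_relator, kernel_word}"
  by (simp_all add: BS_quot_def)

lemma relators_in_words [simp]: "bs_relator \<in> words {0, Suc 0}" "kernel_word \<in> words {0, Suc 0}"
  by (auto simp: bs_relator_def kernel_word_def)

lemma is_presentation_BS: "is_presentation (BS 2 3)"
  and is_presentation_BS_quot: "is_presentation BS_quot"
  by (simp_all add: is_presentation_def)

lemma (in group) mult_inv_cancel:
  "x \<in> carrier G \<Longrightarrow> y \<in> carrier G \<Longrightarrow> x \<otimes> (inv x \<otimes> y) = y"
  by (simp flip: m_assoc)

lemma (in group) eq_iff_mult_inv:
  "x \<in> carrier G \<Longrightarrow> y \<in> carrier G \<Longrightarrow> x \<otimes> inv y = \<one> \<longleftrightarrow> x = y"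
  by (metis inv_closed inv_equality inv_inv r_inv)

lemma (in group) word_val_bs_relator:
  assumes "\<phi> 0 \<in> carrier G" "\<phi> 1 \<in> carrier G"
  shows "word_val G \<phi> bs_relator = \<one> \<longleftrightarrow> conj_by (\<phi> 0) (\<phi> 1 \<otimes> \<phi> 1) = \<phi> 1 \<otimes> \<phi> 1 \<otimes> \<phi> 1"
proof -
  have "word_val G \<phi> bs_relator = conj_by (\<phi> 0) (\<phi> 1 \<otimes> \<phi> 1) \<otimes> inv (\<phi> 1 \<otimes> \<phi> 1 \<otimes> \<phi> 1)"
    using assms by (simp add: bs_relator_def conj_by_def m_assoc inv_mult_group)
  then show ?thesis using assms by (simp add: eq_iff_mult_inv)
qed

lemma (in group) word_val_kernel_word:
  assumes "\<phi> 0 \<in> carrier G" "\<phi> 1 \<in> carrier G"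
  shows "word_val G \<phi> kernel_word = \<one> \<longleftrightarrow>
    conj_by (\<phi> 0) (\<phi> 1) \<otimes> \<phi> 1 = \<phi> 1 \<otimes> conj_by (\<phi> 0) (\<phi> 1)"
proof -
  have "word_val G \<phi> kernel_word = conj_by (\<phi> 0) (\<phi> 1) \<otimes> \<phi> 1 \<otimes> inv (\<phi> 1 \<otimes> conj_by (\<phi> 0) (\<phi> 1))"
    using assms by (simp add: kernel_word_def conj_by_def m_assoc inv_mult_group)
  then show ?thesis using assms by (simp add: eq_iff_mult_inv)
qed

lemma BS_relation:
  defines "P \<equiv> BS 2 3"
  defines "G \<equiv> presented_group P"
  shows "group.conj_by G (gen_class P 0) (gen_class P 1 \<otimes>\<^bsub>G\<^esub> gen_class P 1) =
    gen_class P 1 \<otimes>\<^bsub>G\<^esub> gen_class P 1 \<otimes>\<^bsub>G\<^esub> gen_class P 1"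
proof -
  interpret group G unfolding G_def P_def by (rule group_presented_group[OF is_presentation_BS])
  have "word_val G (gen_class P) bs_relator = \<one>\<^bsub>G\<^esub>"
    using word_eq.relator[of "[]" "BS 2 3" "[]" bs_relator]
    by (simp add: word_val_gen_class[OF is_presentation_BS] one_presented_group word_class_eq_iff G_def P_def)
  moreover have "gen_class P \<in> {0, 1} \<rightarrow> carrier G"
    using gen_class_closed[of P] by (simp add: G_def P_def)
  ultimately show ?thesis
    using word_val_bs_relator[of "gen_class P"] by auto
qed

text \<open>Modulo the commutator, the endomorphism \<open>s \<mapsto> s\<close>,
  \<open>t \<mapsto> t\<^sup>2\<close> is inverted by \<open>t \<mapsto> s\<inverse>tst\<inverse>\<close>.\<close>

lemma BS_iso_BS_quot: "presented_group (BS 2 3) \<cong> presented_group BS_quot"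
proof -
  let ?P = "presented_group (BS 2 3)" and ?Q = "presented_group BS_quot"
  interpret P: group ?P by (rule group_presented_group[OF is_presentation_BS])
  interpret Q: group ?Q by (rule group_presented_group[OF is_presentation_BS_quot])
  define s t where "s = gen_class (BS 2 3) 0" and "t = gen_class (BS 2 3) (Suc 0)"
  define s' t' where "s' = gen_class BS_quot 0" and "t' = gen_class BS_quot (Suc 0)"
  have [simp]: "s \<in> carrier ?P" "t \<in> carrier ?P" "s' \<in> carrier ?Q" "t' \<in> carrier ?Q"
    using gen_class_closed[of "BS 2 3"] gen_class_closed[of BS_quot]
    by (auto simp: s_def t_def s'_def t'_def)
  have rel: "P.conj_by s (t \<otimes>\<^bsub>?P\<^esub> t) = t \<otimes>\<^bsub>?P\<^esub> t \<otimes>\<^bsub>?P\<^esub> t"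
    using BS_relation by (simp add: s_def t_def)
  have "word_val ?Q (gen_class BS_quot) bs_relator = \<one>\<^bsub>?Q\<^esub>" "word_val ?Q (gen_class BS_quot) kernel_word = \<one>\<^bsub>?Q\<^esub>"
    using word_eq.relator[of "[]" "BS_quot" "[]" bs_relator] word_eq.relator[of "[]" "BS_quot" "[]" kernel_word]
    by (simp_all add: word_val_gen_class[OF is_presentation_BS_quot] one_presented_group word_class_eq_iff)
  then have rel': "Q.conj_by s' (t' \<otimes>\<^bsub>?Q\<^esub> t') = t' \<otimes>\<^bsub>?Q\<^esub> t' \<otimes>\<^bsub>?Q\<^esub> t'"
    "Q.conj_by s' t' \<otimes>\<^bsub>?Q\<^esub> t' = t' \<otimes>\<^bsub>?Q\<^esub> Q.conj_by s' t'"
    using Q.word_val_bs_relator[of "gen_class BS_quot"] Q.word_val_kernel_word[of "gen_class BS_quot"]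
    by (simp_all add: s'_def[symmetric] t'_def[symmetric])
  define a where "a = Q.conj_by s' t'"
  \<comment> \<open>The endomorphism sends \<open>s^-1 t s t^-1\<close> to
    \<open>t^3 t^-2 = t\<close>, so its inverse has to send \<open>t\<close> to this element, a
    square root of \<open>t'\<close>.\<close>
  define u where "u = a \<otimes>\<^bsub>?Q\<^esub> inv\<^bsub>?Q\<^esub> t'"
  have [simp]: "a \<in> carrier ?Q" "u \<in> carrier ?Q" by (simp_all add: a_def u_def)
  have at: "a \<otimes>\<^bsub>?Q\<^esub> t' = t' \<otimes>\<^bsub>?Q\<^esub> a" using rel'(2) by (simp add: a_def)
  have aa: "a \<otimes>\<^bsub>?Q\<^esub> a = t' \<otimes>\<^bsub>?Q\<^esub> t' \<otimes>\<^bsub>?Q\<^esub> t'" using rel'(1) by (simp add: a_def Q.conj_by_mult)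
  have ta: "inv\<^bsub>?Q\<^esub> t' \<otimes>\<^bsub>?Q\<^esub> a = a \<otimes>\<^bsub>?Q\<^esub> inv\<^bsub>?Q\<^esub> t'"
  proof -
    have "t' \<otimes>\<^bsub>?Q\<^esub> a \<otimes>\<^bsub>?Q\<^esub> inv\<^bsub>?Q\<^esub> t' = a"
      by (simp add: at[symmetric] Q.m_assoc)
    then show ?thesis by (simp add: Q.inv_solve_left' Q.m_assoc)
  qed
  \<comment> \<open>Commutation reorders \<open>u u\<close> into \<open>a^2 t'^-2\<close>, and
    \<open>a^2\<close> is the conjugate of \<open>t'^2\<close>, that is \<open>t'^3\<close>.\<close>
  have uu: "u \<otimes>\<^bsub>?Q\<^esub> u = t'"
  proof -
    have "u \<otimes>\<^bsub>?Q\<^esub> u = a \<otimes>\<^bsub>?Q\<^esub> (inv\<^bsub>?Q\<^esub> t' \<otimes>\<^bsub>?Q\<^esub> a) \<otimes>\<^bsub>?Q\<^esub> inv\<^bsub>?Q\<^esub> t'"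
      by (simp add: u_def Q.m_assoc)
    also have "\<dots> = (a \<otimes>\<^bsub>?Q\<^esub> a) \<otimes>\<^bsub>?Q\<^esub> (inv\<^bsub>?Q\<^esub> t' \<otimes>\<^bsub>?Q\<^esub> inv\<^bsub>?Q\<^esub> t')"
      unfolding ta by (simp add: Q.m_assoc)
    also have "\<dots> = t' \<otimes>\<^bsub>?Q\<^esub> (t' \<otimes>\<^bsub>?Q\<^esub> (t' \<otimes>\<^bsub>?Q\<^esub> inv\<^bsub>?Q\<^esub> t') \<otimes>\<^bsub>?Q\<^esub> inv\<^bsub>?Q\<^esub> t')"
      unfolding aa by (simp only: Q.m_assoc Q.m_closed Q.inv_closed \<open>t' \<in> carrier ?Q\<close>)
    finally show ?thesis by simp
  qed
  \<comment> \<open>With \<open>uu\<close> this gives the relator of \<open>BS(2,3)\<close> for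
    \<open>s'\<close> and \<open>u\<close>: conjugation by \<open>s'\<close> sends
    \<open>u^2 = t'\<close> to \<open>a\<close>, and \<open>u^3 = t' u\<close>.\<close>
  have tu: "t' \<otimes>\<^bsub>?Q\<^esub> u = a"
    using at by (simp add: u_def Q.m_assoc[symmetric] Q.inv_solve_right')
  define f :: "nat letter list set \<Rightarrow> nat letter list set"
    where "f = induced_hom ?Q (\<lambda>i. if i = 0 then s' else u)"
  define g :: "nat letter list set \<Rightarrow> nat letter list set"
    where "g = induced_hom ?P (\<lambda>i. if i = 0 then s else t \<otimes>\<^bsub>?P\<^esub> t)"
  have f_rel: "word_val ?Q (\<lambda>i. if i = 0 then s' else u) r = \<one>\<^bsub>?Q\<^esub>" if "r \<in> snd (BS 2 3)" for r
    using that Q.word_val_bs_relator[of "\<lambda>i. if i = 0 then s' else u"]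
    by (simp add: uu tu a_def)
  \<comment> \<open>Conjugation by \<open>s\<close> sends \<open>t^4\<close> to \<open>t^6\<close>,
    and \<open>t^3\<close> commutes with \<open>t^2\<close>.\<close>
  have g_rel: "word_val ?P (\<lambda>i. if i = 0 then s else t \<otimes>\<^bsub>?P\<^esub> t) r = \<one>\<^bsub>?P\<^esub>" if "r \<in> snd BS_quot" for r
  proof -
    have "P.conj_by s (t \<otimes>\<^bsub>?P\<^esub> t \<otimes>\<^bsub>?P\<^esub> (t \<otimes>\<^bsub>?P\<^esub> t)) =
        P.conj_by s (t \<otimes>\<^bsub>?P\<^esub> t) \<otimes>\<^bsub>?P\<^esub> P.conj_by s (t \<otimes>\<^bsub>?P\<^esub> t)"
      by (rule P.conj_by_mult) simp_all
    also have "\<dots> = t \<otimes>\<^bsub>?P\<^esub> t \<otimes>\<^bsub>?P\<^esub> (t \<otimes>\<^bsub>?P\<^esub> t) \<otimes>\<^bsub>?P\<^esub> (t \<otimes>\<^bsub>?P\<^esub> t)"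
      unfolding rel by (simp add: P.m_assoc)
    moreover have "P.conj_by s (t \<otimes>\<^bsub>?P\<^esub> t) \<otimes>\<^bsub>?P\<^esub> (t \<otimes>\<^bsub>?P\<^esub> t) =
        t \<otimes>\<^bsub>?P\<^esub> t \<otimes>\<^bsub>?P\<^esub> P.conj_by s (t \<otimes>\<^bsub>?P\<^esub> t)"
      unfolding rel by (simp add: P.m_assoc)
    ultimately show ?thesis
      using that P.word_val_bs_relator[of "\<lambda>i. if i = 0 then s else t \<otimes>\<^bsub>?P\<^esub> t"]
        P.word_val_kernel_word[of "\<lambda>i. if i = 0 then s else t \<otimes>\<^bsub>?P\<^esub> t"]
      by auto
  qed
  note f = Q.induced_hom_hom[OF is_presentation_BS _ f_rel, folded f_def]
    Q.induced_hom_gen_class[OF is_presentation_BS _ f_rel, folded f_def]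
  note g = P.induced_hom_hom[OF is_presentation_BS_quot _ g_rel, folded g_def]
    P.induced_hom_gen_class[OF is_presentation_BS_quot _ g_rel, folded g_def]
  have f_hom: "f \<in> hom ?P ?Q" and f_s: "f s = s'" and f_t: "f t = u"
    using f unfolding s_def t_def by simp_all
  have g_hom: "g \<in> hom ?Q ?P" and g_s: "g s' = s" and g_t: "g t' = t \<otimes>\<^bsub>?P\<^esub> t"
    using g unfolding s'_def t'_def by simp_all
  interpret f: group_hom ?P ?Q f by unfold_locales (rule f_hom)
  interpret g: group_hom ?Q ?P g by unfold_locales (rule g_hom)
  have "f (g t') = t'" by (simp add: g_t f_t uu)
  moreover have "g (f t) = t"
  proof -
    have "g (f t) = P.conj_by s (t \<otimes>\<^bsub>?P\<^esub> t) \<otimes>\<^bsub>?P\<^esub> inv\<^bsub>?P\<^esub> (t \<otimes>\<^bsub>?P\<^esub> t)"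
      by (simp add: f_t u_def a_def Q.conj_by_def P.conj_by_def g_s g_t)
    then show ?thesis unfolding rel by (simp add: P.m_assoc P.inv_mult_group P.mult_inv_cancel)
  qed
  ultimately show ?thesis
    using f_hom g_hom f_s g_s unfolding s_def t_def s'_def t'_def
    by (intro presented_group_iso[OF is_presentation_BS is_presentation_BS_quot, of f g]) auto
qed

section \<open>The word problem for \<open>BS(2,3)\<close>\<close>

text \<open>
  The state \<open>(k, [(b\<^sub>n, a\<^sub>n), \<dots>, (b\<^sub>1, a\<^sub>1)])\<close> stands for the
  element \<open>t^a\<^sub>1 s^b\<^sub>1 \<dots> t^a\<^sub>n s^b\<^sub>n t^k\<close>, where
  \<open>s^True = s\<close> and \<open>s^False = s\<inverse>\<close>. Letters act by right multiplication, via
  \<open>t^(2q) s = s t^(3q)\<close> and \<open>t^(3q) s\<inverse> = s\<inverse> t^(2q)\<close>.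
\<close>

type_synonym bs_state = "int \<times> (bool \<times> int) list"

text \<open>\<open>t^(base b)\<close> passes the stable letter \<open>s^b\<close> and emerges as
  \<open>t^(base (\<not> b))\<close>.\<close>

definition base :: "bool \<Rightarrow> int" where
  "base b = (if b then 2 else 3)"

text \<open>Of \<open>t^k\<close>, the multiple of \<open>base b\<close> is carried across and the
  remainder stays as a coset representative. An entry is popped exactly at a pinch, where opposite
  stable letters surround a power that can pass; its exponent \<open>a\<close> then rejoins the top
  power.\<close>

fun move :: "bool \<Rightarrow> bs_state \<Rightarrow> bs_state" where
  "move b (k, []) = (base (\<not> b) * (k div base b), [(b, k mod base b)])"
| "move b (k, (c, a) # st) =
    (if c \<noteq> b \<and> k mod base b = 0 then (base (\<not> b) * (k div base b) + a, st)
     else (base (\<not> b) * (k div base b), (b, k mod base b) # (c, a) # st))"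

fun act :: "nat letter \<Rightarrow> bs_state \<Rightarrow> bs_state" where
  "act (Gen i) \<sigma> = (if i = 0 then move True \<sigma> else (fst \<sigma> + 1, snd \<sigma>))"
| "act (Inv i) \<sigma> = (if i = 0 then move False \<sigma> else (fst \<sigma> - 1, snd \<sigma>))"

text \<open>Britton normal form: coset representatives in front of the stable letters, and the last
  clause excludes adjacent opposite stable letters.\<close>

fun reduced :: "(bool \<times> int) list \<Rightarrow> bool" where
  "reduced [] \<longleftrightarrow> True"
| "reduced ((b, a) # st) \<longleftrightarrow>
    0 \<le> a \<and> a < base b \<and> reduced st \<and> (a = 0 \<longrightarrow> st = [] \<or> fst (hd st) = b)"

section \<open>The action on reduced states\<close>

lemma base_pos [simp]: "base b > 0" and base_nonzero [simp]: "base b \<noteq> 0"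
  by (simp_all add: base_def)

lemma reduced_move: "reduced (snd \<sigma>) \<Longrightarrow> reduced (snd (move b \<sigma>))"
  by (cases "(b, \<sigma>)" rule: move.cases) auto

text \<open>A push is undone by a pop. A pop is undone by a push because the popped \<open>a\<close>
  is its own remainder, and the last clause of \<open>reduced\<close> prevents a second pop
  instead.\<close>

lemma move_move: "reduced (snd \<sigma>) \<Longrightarrow> move (\<not> b) (move b \<sigma>) = \<sigma>"
proof (cases "(b, \<sigma>)" rule: move.cases)
  case (2 b k c a st)
  assume "reduced (snd \<sigma>)"
  then show ?thesis
    using 2 mult_div_mod_eq[of "base b" k] by (cases st) (auto simp: mod_pos_pos_trivial div_pos_pos_trivial)
qed auto

text \<open>The defining relation as it acts on states: only the quotient by \<open>base b\<close>
  changes, by one.\<close>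

lemma move_shift:
  "move b (k + base b, st) = (fst (move b (k, st)) + base (\<not> b), snd (move b (k, st)))"
proof -
  have "(k + base b) div base b = k div base b + 1" "(k + base b) mod base b = k mod base b"
    by (simp_all add: div_add_self2)
  then show ?thesis
    by (cases "(b, (k, st))" rule: move.cases) (auto simp: algebra_simps)
qed

lemma reduced_act: "reduced (snd \<sigma>) \<Longrightarrow> reduced (snd (act x \<sigma>))"
  by (cases x) (auto simp: reduced_move)

lemma reduced_fold_act: "reduced (snd \<sigma>) \<Longrightarrow> reduced (snd (fold act w \<sigma>))"
  by (induction w arbitrary: \<sigma>) (auto simp: reduced_act)

lemma act_act_inv_letter: "reduced (snd \<sigma>) \<Longrightarrow> act (inv_letter x) (act x \<sigma>) = \<sigma>"
  using move_move[of \<sigma> True] move_move[of \<sigma> False] by (cases x) auto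

text \<open>The second \<open>move\<close> undoes the first, except for the raise by 2 in between,
  which \<open>move_shift\<close> turns into a raise by 3; the final letters cancel it.\<close>

lemma fold_act_bs_relator:
  assumes "reduced (snd \<sigma>)"
  shows "fold act bs_relator \<sigma> = \<sigma>"
proof -
  obtain k st where k: "move False \<sigma> = (k, st)" by fastforce
  then have "move True (k, st) = \<sigma>" using move_move[OF assms, of False] by simp
  then have "move True (2 + k, st) = (fst \<sigma> + 3, snd \<sigma>)"
    using move_shift[of True k st] by (simp add: base_def add.commute)
  then show ?thesis by (simp add: bs_relator_def k)
qed

lemma fold_act_eq_if_word_eq:
  assumes "word_eq (BS 2 3) v w" "reduced (snd \<sigma>)"
  shows "fold act v \<sigma> = fold act w \<sigma>"
  using assms
  by (induction arbitrary: \<sigma>)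
    (simp_all add: act_act_inv_letter reduced_fold_act fold_act_bs_relator)

text \<open>The head of the stack is the last syllable, so \<open>foldr\<close> builds the product
  from the bottom of the stack by multiplying on the right.\<close>

definition (in group) stack_val :: "'a \<Rightarrow> 'a \<Rightarrow> (bool \<times> int) list \<Rightarrow> 'a" where
  "stack_val s t st = foldr (\<lambda>(b, a) g. g \<otimes> t [^] a \<otimes> (if b then s else inv s)) st \<one>"

definition (in group) state_val :: "'a \<Rightarrow> 'a \<Rightarrow> bs_state \<Rightarrow> 'a" where
  "state_val s t \<sigma> = stack_val s t (snd \<sigma>) \<otimes> t [^] fst \<sigma>"

lemma (in group) stack_val_closed [simp]:
  assumes "s \<in> carrier G" "t \<in> carrier G"
  shows "stack_val s t st \<in> carrier G"
  unfolding stack_val_def using assms by (induction st) auto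

lemma (in group) state_val_closed [simp]:
  "s \<in> carrier G \<Longrightarrow> t \<in> carrier G \<Longrightarrow> state_val s t \<sigma> \<in> carrier G"
  by (simp add: state_val_def)

lemma (in group) int_pow_conj_by:
  assumes "s \<in> carrier G" "x \<in> carrier G"
  shows "conj_by s x [^] (q::int) = conj_by s (x [^] q)"
proof -
  have "conj_by s \<in> hom G G"
    using assms by (auto intro!: homI simp: conj_by_mult)
  then interpret group_hom G G "conj_by s" by unfold_locales
  show ?thesis using assms by (simp add: hom_int_pow)
qed

section \<open>Evaluating states in a group that satisfies the relation\<close>

context group
begin

context
  fixes s t
  assumes st [simp]: "s \<in> carrier G" "t \<in> carrier G"
    and rel: "conj_by s (t \<otimes> t) = t \<otimes> t \<otimes> t"
begin

abbreviation stable :: "bool \<Rightarrow> 'a" where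
  "stable b \<equiv> (if b then s else inv s)"

text \<open>For \<open>s\<close> this is the relation raised to the power \<open>q\<close>, since
  conjugation is a homomorphism; multiplying by \<open>inv s\<close> on both sides gives the other
  case.\<close>

lemma int_pow_mult_stable:
  "t [^] (base b * q) \<otimes> stable b = stable b \<otimes> t [^] (base (\<not> b) * q)"
proof -
  have "t [^] (2 :: int) = t \<otimes> t" "t [^] (3 :: int) = t \<otimes> t \<otimes> t"
    using int_pow_mult[of t 1 1] int_pow_mult[of t 2 1] by simp_all
  then have "t [^] (2 * q) = (t \<otimes> t) [^] q" "t [^] (3 * q) = (t \<otimes> t \<otimes> t) [^] q"
    by (simp_all add: int_pow_pow[symmetric])
  then have "conj_by s (t [^] (2 * q)) = t [^] (3 * q)"
    using int_pow_conj_by[of s "t \<otimes> t" q] rel by simp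
  then have eq: "t [^] (2 * q) \<otimes> s = s \<otimes> t [^] (3 * q)"
    by (simp add: conj_by_def m_assoc inv_solve_left')
  have "t [^] (3 * q) \<otimes> inv s = inv s \<otimes> t [^] (2 * q)"
  proof -
    have "s \<otimes> (t [^] (3 * q) \<otimes> inv s) = t [^] (2 * q) \<otimes> s \<otimes> inv s"
      by (simp add: eq m_assoc)
    also have "\<dots> = t [^] (2 * q)"
      by (simp add: m_assoc)
    finally show ?thesis by (simp add: inv_solve_left)
  qed
  with eq show ?thesis by (simp add: base_def)
qed

lemma stack_val_Cons: "stack_val s t ((b, a) # stk) = stack_val s t stk \<otimes> t [^] a \<otimes> stable b"
  by (simp add: stack_val_def)

lemma state_val_move: "state_val s t (move b \<sigma>) = state_val s t \<sigma> \<otimes> stable b"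
proof -
  have split: "t [^] k \<otimes> stable b = t [^] (k mod base b) \<otimes> stable b \<otimes> t [^] (base (\<not> b) * (k div base b))" for k
  proof -
    have "t [^] k = t [^] (k mod base b) \<otimes> t [^] (base b * (k div base b))"
      by (simp add: int_pow_mult[symmetric])
    then show ?thesis
      using int_pow_mult_stable[of b "k div base b"] by (simp add: m_assoc)
  qed
  show ?thesis
  proof (cases "(b, \<sigma>)" rule: move.cases)
    case (1 b' k)
    then show ?thesis using split[of k] by (simp add: state_val_def stack_val_def)
  next
    case (2 b' k c a st)
    show ?thesis
    proof (cases "c \<noteq> b \<and> k mod base b = 0")
      case True
      \<comment> \<open>At a pinch the two stable letters are mutually inverse.\<close>
      have "stable c \<otimes> (stable b \<otimes> x) = x" if "x \<in> carrier G" for x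
        using that True by (auto simp flip: m_assoc)
      moreover have "state_val s t \<sigma> \<otimes> stable b =
        stack_val s t st \<otimes> t [^] a \<otimes> stable c \<otimes> (t [^] k \<otimes> stable b)"
        using 2 by (simp add: state_val_def stack_val_Cons m_assoc)
      ultimately have "state_val s t \<sigma> \<otimes> stable b =
        stack_val s t st \<otimes> t [^] a \<otimes> t [^] (base (\<not> b) * (k div base b))"
        using True split[of k] by (simp add: m_assoc)
      then show ?thesis
        using 2 True by (simp add: state_val_def m_assoc int_pow_mult[symmetric] add.commute)
    next
      case False
      have "state_val s t \<sigma> \<otimes> stable b = stack_val s t (snd \<sigma>) \<otimes> (t [^] k \<otimes> stable b)"
        using 2 by (simp add: state_val_def m_assoc)
      also have "\<dots> = stack_val s t ((b, k mod base b) # snd \<sigma>) \<otimes> t [^] (base (\<not> b) * (k div base b))"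
        unfolding split[of k] by (simp add: stack_val_Cons m_assoc)
      also have "\<dots> = state_val s t (move b \<sigma>)"
        using 2 False by (simp add: state_val_def split del: if_split) auto
      finally show ?thesis by simp
    qed
  qed
qed

lemma state_val_act:
  assumes "x \<in> letters {0, 1}" "\<phi> 0 = s" "\<phi> 1 = t"
  shows "state_val s t (act x \<sigma>) = state_val s t \<sigma> \<otimes> letter_val G \<phi> x"
proof -
  have "x \<in> {Gen 0, Inv 0, Gen 1, Inv 1}"
    using assms(1) by (cases x) auto
  then show ?thesis
    using state_val_move[of True \<sigma>] state_val_move[of False \<sigma>] int_pow_mult[of t "fst \<sigma>" 1]
      int_pow_diff[of t "fst \<sigma>" 1] assms(2,3)
    by (elim insertE) (simp_all add: state_val_def m_assoc)
qed

lemma state_val_fold_act: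
  assumes "w \<in> words {0, 1}" "\<phi> 0 = s" "\<phi> 1 = t"
  shows "state_val s t (fold act w \<sigma>) = state_val s t \<sigma> \<otimes> word_val G \<phi> w"
  using assms(1)
proof (induction w arbitrary: \<sigma>)
  case Nil
  then show ?case by simp
next
  case (Cons x w)
  have "\<phi> \<in> {0, 1} \<rightarrow> carrier G" using assms by auto
  then show ?case
    using Cons state_val_act[OF _ assms(2,3)] letter_val_closed[of \<phi> "{0, 1}" x]
      word_val_closed[of \<phi> "{0, 1}" w]
    by (simp add: m_assoc)
qed

end

end

text \<open>Equal words act equally, which is one direction. Conversely, the value of the final
  state is that of the initial state, namely 1, times the value of the word. The action takes the
  place of Britton's lemma.\<close>

lemma BS_word_eq_Nil_iff:
  assumes "w \<in> words {0, 1}"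
  shows "word_eq (BS 2 3) w [] \<longleftrightarrow> fold act w (0, []) = (0, [])"
proof
  assume "word_eq (BS 2 3) w []"
  from fold_act_eq_if_word_eq[OF this, of "(0, [])"] show "fold act w (0, []) = (0, [])" by simp
next
  assume fixed: "fold act w (0, []) = (0, [])"
  let ?P = "BS 2 3" and ?G = "presented_group (BS 2 3)"
  interpret group ?G by (rule group_presented_group[OF is_presentation_BS])
  have gens: "gen_class ?P \<in> {0, 1} \<rightarrow> carrier ?G"
    using gen_class_closed[of ?P] by simp
  then have "state_val (gen_class ?P 0) (gen_class ?P 1) (0, []) =
      state_val (gen_class ?P 0) (gen_class ?P 1) (0, []) \<otimes>\<^bsub>?G\<^esub> word_val ?G (gen_class ?P) w"
    using state_val_fold_act[OF _ _ BS_relation assms, of "gen_class ?P" "(0, [])"] fixed by auto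
  then have "word_val ?G (gen_class ?P) w = \<one>\<^bsub>?G\<^esub>"
    using word_val_closed[OF gens assms] by (simp add: state_val_def stack_val_def)
  then show "word_eq ?P w []"
    using assms word_val_gen_class[OF is_presentation_BS, of w]
    by (simp add: one_presented_group word_class_eq_iff word_eq.sym)
qed

text \<open>Reading the word never meets a pinch: the exponents 1, 1, -1 in front of the last three
  stable letters are not divisible by 2, 3, 2 respectively, so four entries remain on the
  stack.\<close>

lemma kernel_word_nontrivial: "\<not> word_eq (BS 2 3) kernel_word []"
  by (subst BS_word_eq_Nil_iff) (simp_all add: kernel_word_def base_def)

section \<open>A program for the word problem\<close>

text \<open>A state is coded by \<open>(A, B, L)\<close> with \<open>k = A - B\<close>, so that division with
  remainder of \<open>k\<close> by \<open>m\<close> is division of the natural number \<open>A + (m - 1) B = k + m B\<close>.\<close>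

definition decode_state :: "nat \<Rightarrow> bs_state" where
  "decode_state z = (int (pfst z) - int (pfst (psnd z)),
    map (\<lambda>e. (odd e, int (e div 2))) (list_decode (psnd (psnd z))))"

text \<open>For \<open>s^b\<close>, \<open>m\<close> and \<open>n\<close> are \<open>base b\<close>
  and \<open>base (\<not> b)\<close>; the stack entry \<open>(b, a)\<close> is the number
  \<open>2 * a + tag\<close>, odd exactly for \<open>s\<close>.\<close>

definition move_code :: "nat \<Rightarrow> nat \<Rightarrow> nat \<Rightarrow> nat \<Rightarrow> nat" where
  "move_code m n tag z =
    (let A = pfst z; B = pfst (psnd z); L = psnd (psnd z); X = A + (m - 1) * B in
      if L \<noteq> 0 \<and> code_hd L mod 2 \<noteq> tag \<and> X mod m = 0
      then prod_encode (n * (X div m) + code_hd L div 2, prod_encode (n * B, code_tl L))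
      else prod_encode (n * (X div m), prod_encode (n * B, Suc (prod_encode (2 * (X mod m) + tag, L)))))"

lemma computable_move_code [computable_intros]:
  "m > 0 \<Longrightarrow> computable f \<Longrightarrow> computable (\<lambda>x. move_code m n tag (f x))"
  unfolding move_code_def Let_def by (intro computable_intros zero_less_numeral)

lemma decode_move_code:
  assumes "int m = base b" "int n = base (\<not> b)" "tag = of_bool b"
  shows "decode_state (move_code m n tag z) = move b (decode_state z)"
proof -
  obtain A B l where z: "z = prod_encode (A, prod_encode (B, list_encode l))"
    by (metis list_decode_inverse prod_encode_pfst_psnd)
  have m: "m > 0" using assms(1) base_pos[of b] by linarith
  define k where "k = int A - int B"
  define X where "X = A + (m - Suc 0) * B"
  have X: "int X = k + int m * int B"
    using m by (cases m) (simp_all add: X_def k_def algebra_simps)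
  have X_div: "int (X div m) = k div base b + int B" and X_mod: "int (X mod m) = k mod base b"
    unfolding zdiv_int zmod_int X assms(1)[symmetric] using m by simp_all
  have X_mod_0: "X mod m = 0 \<longleftrightarrow> k mod base b = 0"
    using X_mod by linarith
  \<comment> \<open>The quotient of \<open>X\<close> exceeds that of \<open>k\<close> by
    \<open>B\<close>; the new subtrahend \<open>n * B\<close> cancels the excess.\<close>
  have shift: "int (n * (X div m)) - int (n * B) = base (\<not> b) * (k div base b)"
    using X_div assms(2) by (simp add: algebra_simps)
  show ?thesis
  proof (cases l)
    case Nil
    then show ?thesis
      using shift X_mod assms(3)
      by (simp add: decode_state_def move_code_def z Let_def X_def[symmetric] k_def[symmetric]
          del: of_nat_mult)
  next
    case (Cons e l')
    have "e mod 2 \<noteq> tag \<longleftrightarrow> odd e \<noteq> b" using assms(3) by (auto simp: mod_2_eq_odd)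
    then show ?thesis
      using shift X_mod X_mod_0 assms(3) Cons
      by (simp add: decode_state_def move_code_def z Let_def X_def[symmetric] k_def[symmetric]
          del: of_nat_mult list_encode.simps)
  qed
qed

text \<open>Codes 0, 1, 2, 3 belong to \<open>s\<close>, \<open>s^-1\<close>, \<open>t\<close>,
  \<open>t^-1\<close>. The last raises the subtrahend, so no negative number has to be
  coded.\<close>

definition act_code :: "nat \<Rightarrow> nat \<Rightarrow> nat" where
  "act_code l z =
    (if l = 0 then move_code 2 3 1 z
     else if l = 1 then move_code 3 2 0 z
     else if l = 2 then prod_encode (Suc (pfst z), psnd z)
     else prod_encode (pfst z, prod_encode (Suc (pfst (psnd z)), psnd (psnd z))))"

lemma decode_act_code:
  "x \<in> letters {0, 1} \<Longrightarrow> decode_state (act_code (letter_code x) z) = act x (decode_state z)"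
  by (cases x)
    (auto simp: act_code_def decode_move_code base_def, auto simp: decode_state_def)

lemma decode_fold_act_code:
  "w \<in> words {0, 1} \<Longrightarrow>
    decode_state (fold act_code (map letter_code w) z) = fold act w (decode_state z)"
  by (induction w arbitrary: z) (auto simp: decode_act_code[simplified])

text \<open>The code of a list bounds its length and \<open>step\<close> idles on the empty list, so
  iterating as often as the code says completes the fold.\<close>

lemma computable_fold:
  assumes "computable2 h" "computable f" "computable b"
  shows "computable (\<lambda>x. fold h (list_decode (f x)) (b x))"
proof -
  define step where "step z =
    (if pfst z = 0 then z else prod_encode (code_tl (pfst z), h (code_hd (pfst z)) (psnd z)))" for z
  have "(step ^^ n) (prod_encode (list_encode xs, z)) = prod_encode (0, fold h xs z)"
    if "length xs \<le> n" for n xs z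
    using that
  proof (induction n arbitrary: xs z)
    case (Suc n)
    show ?case
    proof (cases xs)
      case Nil
      have "step (prod_encode (0, z)) = prod_encode (0, z)" by (simp add: step_def)
      then show ?thesis
        using Nil Suc.IH[of "[]" z] by (simp add: funpow_Suc_right del: funpow.simps)
    next
      case (Cons y ys)
      have "step (prod_encode (list_encode (y # ys), z)) = prod_encode (list_encode ys, h y z)"
        unfolding step_def pfst_prod_encode psnd_prod_encode code_hd_list_encode code_tl_list_encode by simp
      then show ?thesis
        using Cons Suc.IH[of ys "h y z"] Suc.prems
        by (simp add: funpow_Suc_right del: funpow.simps list_encode.simps)
    qed
  qed simp
  from this[OF length_le_list_encode]
  have "fold h (list_decode L) z = psnd ((step ^^ L) (prod_encode (L, z)))" for L z
    by (metis list_decode_inverse psnd_prod_encode)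
  moreover have "computable (\<lambda>x. psnd ((step ^^ f x) (prod_encode (f x, b x))))"
    unfolding step_def using assms(2,3) by (intro computable_intros computable2_app[OF assms(1)])
  ultimately show ?thesis by (simp only:)
qed

lemma solvable_BS: "solvable_word_problem (BS 2 3)"
proof -
  define F where "F W = fold act_code (list_decode W) 0" for W
  \<comment> \<open>Exponent 0 has many codes, hence the comparison of its two components instead of
    a test for code 0.\<close>
  define triv where "triv z \<longleftrightarrow> pfst z = pfst (psnd z) \<and> psnd (psnd z) = 0" for z
  have "computable2 act_code"
    unfolding computable2_def act_code_def by (intro computable_intros zero_less_numeral)
  then have "computable F"
    unfolding F_def by (intro computable_fold computable_intros)
  then have "computable (\<lambda>W. if triv (F W) then 1 else 0)"
    unfolding triv_def by (intro computable_intros)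
  then obtain c where c: "\<And>W. eval c W (if triv (F W) then 1 else 0)"
    by (auto simp: computable_def)
  have triv_F: "triv (F (word_code w)) \<longleftrightarrow> word_class (BS 2 3) w = \<one>\<^bsub>presented_group (BS 2 3)\<^esub>"
    if "w \<in> words {0, 1}" for w
  proof -
    have "decode_state 0 = (0, [])"
      by (simp add: decode_state_def)
    then have "decode_state (F (word_code w)) = fold act w (0, [])"
      using decode_fold_act_code[OF that] by (simp add: F_def word_code_def)
    moreover have "triv z \<longleftrightarrow> decode_state z = (0, [])" for z
      by (cases "psnd (psnd z)") (auto simp: triv_def decode_state_def split: prod.splits)
    ultimately show ?thesis
      using BS_word_eq_Nil_iff[OF that] by (simp add: one_presented_group word_class_eq_iff)
  qed
  have "solves_word_problem c (BS 2 3)"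
    unfolding solves_word_problem_def
  proof
    fix w assume "w \<in> words (fst (BS 2 3))"
    then have "w \<in> words {0, 1}" by simp
    from c[of "word_code w", unfolded triv_F[OF this]]
    show "eval c (word_code w) (if word_class (BS 2 3) w = \<one>\<^bsub>presented_group (BS 2 3)\<^esub> then 1 else 0)" .
  qed
  then show ?thesis by (auto simp: solvable_word_problem_def)
qed

section \<open>No uniform solution of the word problem\<close>

inductive_simps eval_Tuple_iff: "eval (Tuple f g) x z"
inductive_simps eval_PrimRec_0_iff: "eval (PrimRec f g) (prod_encode (a, 0)) y"
inductive_simps eval_PrimRec_Suc_iff: "eval (PrimRec f g) (prod_encode (a, Suc n)) y"

lemma eval_const_prog_iff: "eval (const_prog n) x y \<longleftrightarrow> y = n"
  using eval_const_prog eval_deterministic by blast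

lemma eval_identity_iff: "eval (Tuple Proj1 Proj2) x y \<longleftrightarrow> y = x"
  using eval_identity eval_deterministic by blast

lemma eval_Proj1_iff: "eval Proj1 x y \<longleftrightarrow> y = pfst x"
  using eval_Proj1_pfst eval_deterministic by blast

text \<open>\<open>5 + 4 * prod_encode (1, y)\<close> is the code of \<open>Succ\<close> composed
  with the program coded by \<open>y\<close>. Hardwiring a number into a program is thus computable
  on codes.\<close>

lemma computable_prog_code_const_prog [computable_intros]:
  assumes "computable f"
  shows "computable (\<lambda>x. prog_code (const_prog (f x)))"
proof -
  have "rec_nat 0 (\<lambda>_ y. 5 + 4 * prod_encode (1, y)) n = prog_code (const_prog n)" for n
    by (induction n) auto
  moreover have "computable (\<lambda>x. rec_nat 0 (\<lambda>_ y. 5 + 4 * prod_encode (1, y)) (f x))"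
    using assms by (intro computable_intros)
  ultimately show ?thesis by simp
qed

lemma conditional_enumeration:
  fixes r w :: nat
  obtains E where "computable (\<lambda>x. prog_code (E x))"
    "\<And>x. {n. \<exists>i. eval (E x) i n} = insert r (if \<exists>y. eval H x y then {w} else {})"
proof -
  \<comment> \<open>A constant composed with \<open>H\<close> still diverges where \<open>H\<close>
    does, so positive indices yield \<open>w\<close> only if \<open>H\<close> halts, while index 0
    always yields \<open>r\<close>.\<close>
  define E where "E = PrimRec (const_prog r) (Compose (const_prog w) (Compose H Proj1))"
  have E: "eval E (prod_encode (x, i)) n \<longleftrightarrow> (if i = 0 then n = r else n = w \<and> (\<exists>y. eval H x y))" for x i n
    unfolding E_def
    by (induction i arbitrary: n)
      (auto simp: eval_PrimRec_0_iff eval_PrimRec_Suc_iff eval_Compose_iff eval_const_prog_iff eval_Proj1_iff)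
  \<comment> \<open>The parameter \<open>x\<close> is hardwired by pairing it with the index, as in
    the s-m-n theorem.\<close>
  define E' where "E' x = Compose E (Tuple (const_prog x) (Tuple Proj1 Proj2))" for x
  have E': "eval (E' x) i n \<longleftrightarrow> eval E (prod_encode (x, i)) n" for x i n
    unfolding E'_def eval_Compose_iff
    by (subst eval_Tuple_iff) (simp add: eval_const_prog_iff eval_identity_iff)
  show ?thesis
  proof
    show "computable (\<lambda>x. prog_code (E' x))"
      unfolding E'_def prog_code.simps(5,6) by (intro computable_intros)
    show "{n. \<exists>i. eval (E' x) i n} = insert r (if \<exists>y. eval H x y then {w} else {})" for x
      by (auto simp: E' E split: if_splits intro: exI[of _ 0] exI[of _ 1])
  qed
qed

text \<open>
  The program \<open>D\<close> halts on \<open>x\<close> iff the solution which \<open>A\<close> outputs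
  for the \<open>x\<close>-th presentation declares the commutator nontrivial. That presentation contains the
  commutator as a relator iff the program with code \<open>x\<close> halts on \<open>x\<close>, so the code of \<open>D\<close> is
  contradictory.
\<close>

lemma no_uniform_solution: "\<not> uniformly_solves_word_problem A (BS 2 3)"
proof
  assume A: "uniformly_solves_word_problem A (BS 2 3)"
  obtain U where U: "\<And>c x y. eval U (prod_encode (prog_code c, x)) y \<longleftrightarrow> eval c x y"
    using universal_program by blast
  \<comment> \<open>Self-application: the input serves both as program code and as argument.\<close>
  define H where "H = Compose U (Tuple (Tuple Proj1 Proj2) (Tuple Proj1 Proj2))"
  have H: "eval H (prog_code c) y \<longleftrightarrow> eval c (prog_code c) y" for c y
    unfolding H_def eval_Compose_iff
    by (subst eval_Tuple_iff) (simp add: eval_identity_iff U)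
  obtain E where E_comp: "computable (\<lambda>x. prog_code (E x))"
    and E: "\<And>x. {n. \<exists>i. eval (E x) i n} =
      insert (word_code bs_relator) (if \<exists>y. eval H x y then {word_code kernel_word} else {})"
    using conditional_enumeration by blast
  have "computable (\<lambda>x. presentation_code {0, 1} (E x))"
    unfolding presentation_code_def using E_comp by (intro computable_intros)
  then obtain pc where pc: "\<And>x. eval pc x (presentation_code {0, 1} (E x))"
    by (auto simp: computable_def)
  \<comment> \<open>\<open>Minimize Proj1\<close> halts exactly on input 0, the answer for a
    nontrivial word.\<close>
  define D where "D = Compose (Minimize Proj1)
    (Compose U (Tuple (Compose A pc) (const_prog (word_code kernel_word))))"
  have D: "(\<exists>y. eval D x y) \<longleftrightarrow> eval c (word_code kernel_word) 0"
    if "eval A (presentation_code {0, 1} (E x)) (prog_code c)" for c x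
  proof -
    have "eval (Compose A pc) x y \<longleftrightarrow> y = prog_code c" for y
      using that pc eval_deterministic eval_Compose_iff by metis
    then have "eval (Tuple (Compose A pc) (const_prog (word_code kernel_word))) x z \<longleftrightarrow>
        z = prod_encode (prog_code c, word_code kernel_word)" for z
      by (subst eval_Tuple_iff) (simp add: eval_const_prog_iff)
    moreover have "(\<exists>n. eval (Minimize Proj1) b n) \<longleftrightarrow> b = 0" for b
      by (auto simp: eval_Minimize_total_iff[OF eval_Proj1_pfst])
    ultimately show ?thesis
      unfolding D_def eval_Compose_iff by (simp add: U) metis
  qed
  \<comment> \<open>This case distinction is made in the logic only; \<open>A\<close> receives the
    enumerating program, whose code is computed without deciding it.\<close>
  define Q where "Q = (if \<exists>y. eval H (prog_code D) y then BS_quot else BS 2 3)"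
  have "recursive_presentation Q (E (prog_code D))"
    using is_presentation_BS is_presentation_BS_quot
    by (auto simp: recursive_presentation_def enumerates_def E Q_def)
  moreover have "presented_group (BS 2 3) \<cong> presented_group Q"
    unfolding Q_def using BS_iso_BS_quot iso_refl by simp
  moreover have Y: "fst Q = {0, 1}" by (simp add: Q_def)
  ultimately obtain c where c: "eval A (presentation_code {0, 1} (E (prog_code D))) (prog_code c)"
    "solves_word_problem c Q"
    using A unfolding uniformly_solves_word_problem_def by metis
  have "eval c (word_code kernel_word) (if word_eq Q kernel_word [] then 1 else 0)"
    using c(2) unfolding solves_word_problem_def one_presented_group
    by (simp add: Y word_class_eq_iff)
  then have "eval c (word_code kernel_word) 0 \<longleftrightarrow> \<not> word_eq Q kernel_word []"
    using eval_deterministic by fastforce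
  moreover have "word_eq Q kernel_word [] \<longleftrightarrow> (\<exists>y. eval H (prog_code D) y)"
    using kernel_word_nontrivial word_eq.relator[of "[]" BS_quot "[]" kernel_word]
    by (simp add: Q_def)
  ultimately show False
    using D[OF c(1)] H by blast
qed

theorem theorem4p1:
  shows "finite_presentation (BS 2 3) \<and>
    solvable_word_problem (BS 2 3) \<and>
    \<not> (\<exists>A. uniformly_solves_word_problem A (BS 2 3))"
  using is_presentation_BS solvable_BS no_uniform_solution by (simp add: finite_presentation_def)

end
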